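(* Let $\zeta$ be the Riemann zeta function, and let $s_1, s_2, \dots$ be the zeros of $\zeta$ lying on the half-line $\{s:\ \mathrm{Re}(s)=\tfrac12,\ \mathrm{Im}(s)>0\}$, each listed according to its multiplicity and ordered by increasing imaginary part. Define the entire function $$h(s)=\frac{1}{2}\prod_{\nu=1}^{\infty}\left(1-\frac{s-s^2}{|s_\nu|^2}\right)$$ and the meromorphic function $\eta$ on $\mathbb{C}$ by $$h(s)=\frac{s}{2}(s-1)\pi^{-s/2}\Gamma\!\left(\frac{s}{2}\right)\eta(s),\quad\text{i.e.}\quad \eta(s)=\frac{2\pi^{s/2}h(s)}{s(s-1)\Gamma(s/2)}.$$ Then the Riemann hypothesis (every zero $s$ of $\zeta$ with $0\le \mathrm{Re}(s)\le 1$ satisfies $\mathrm{Re}(s)=\tfrac12$) holds if and only if $\zeta(s)\equiv\eta(s)$.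
   Context: $\Gamma$ denotes the Euler gamma function. The infinite product defining $h$ converges to an entire function of order at most $1$ whose zeros are exactly the $s_\nu$ and $\overline{s_\nu}$. *)

theory Defs
  imports "HOL-Complex_Analysis.Complex_Analysis"
begin

text \<open>
  The Riemann zeta function: the unique holomorphic continuation of the Dirichlet series to
  the plane without the point \<open>1\<close>. Its value at the pole \<open>1\<close> is set to \<open>0\<close>, the convention the
  library uses for poles of meromorphic functions; it is not a zero of zeta, so \<open>1\<close> has to be
  excluded wherever zeros are mentioned.
\<close>
definition riemann_zeta :: "complex \<Rightarrow> complex" where
  "riemann_zeta = (THE f. f holomorphic_on (- {1}) \<and> f 1 = 0 \<and>
     (\<forall>s. Re s > 1 \<longrightarrow> f s = (\<Sum>n. 1 / of_nat (Suc n) powr s)))"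

definition riemann_hypothesis :: bool where
  "riemann_hypothesis \<longleftrightarrow>
     (\<forall>s. s \<noteq> 1 \<and> riemann_zeta s = 0 \<and> 0 \<le> Re s \<and> Re s \<le> 1 \<longrightarrow> Re s = 1 / 2)"

definition critical_zeros :: "complex set" where
  "critical_zeros = {s. riemann_zeta s = 0 \<and> Re s = 1 / 2 \<and> Im s > 0}"

text \<open>
  The sequence is indexed from \<open>0\<close>. Every zero has positive order, so the last clause also says
  that every zero is listed (finitely often).
\<close>
definition lists_critical_zeros :: "(nat \<Rightarrow> complex) \<Rightarrow> bool" where
  "lists_critical_zeros z \<longleftrightarrow>
     range z \<subseteq> critical_zeros \<and>
     mono (\<lambda>\<nu>. Im (z \<nu>)) \<and>
     (\<forall>w\<in>critical_zeros. int (card {\<nu>. z \<nu> = w}) = zorder riemann_zeta w)"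

definition h_fun :: "(nat \<Rightarrow> complex) \<Rightarrow> complex \<Rightarrow> complex" where
  "h_fun z s = 1 / 2 * (\<Prod>\<nu>. 1 - (s - s\<^sup>2) / of_real ((norm (z \<nu>))\<^sup>2))"

text \<open>
  The quotient is meant as a meromorphic function. Its singularity at \<open>0\<close> is removable, since the
  factor \<open>s\<close> cancels against the pole of \<open>Gamma (s / 2)\<close>; read pointwise, the quotient would take
  the value \<open>0\<close> there by the convention for division by zero.
\<close>
definition eta_fun :: "(nat \<Rightarrow> complex) \<Rightarrow> complex \<Rightarrow> complex" where
  "eta_fun z = remove_sings
     (\<lambda>s. 2 * of_real pi powr (s / 2) * h_fun z s / (s * (s - 1) * Gamma (s / 2)))"

end

theory Submission
  imports Defs "HOL-Probability.Probability" "HOL-Real_Asymp.Real_Asymp"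
begin

text \<open>
  In the variable \<open>w = s - s\<^sup>2\<close> the completed zeta function becomes an entire function \<open>H\<close> of order
  \<open>1/2\<close>, and a zero \<open>s\<^sub>\<nu>\<close> on the critical line becomes the positive real zero \<open>\<bar>s\<^sub>\<nu>\<bar>\<^sup>2\<close> of \<open>H\<close>.
  So \<open>h\<close> is the genus-zero product over these zeros, and it equals \<open>H\<close> if and only if \<open>H\<close> has no
  other zeros.

  The theta transformation and a Mellin transform at real \<open>s > 1\<close> expand \<open>H\<close> in powers of
  \<open>(s - 1/2)\<^sup>2\<close>, with nonnegative coefficients apart from an elementary factor; this gives the
  continuation, the functional equation and the growth bound at once. Dividing \<open>H\<close> by the first \<open>N\<close>
  factors of the product and applying the maximum principle on the circle of radius four times the
  next zero shows that the product converges; if \<open>H\<close> has no other zeros, the Borel-Caratheodory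
  inequality for the logarithm of this quotient shows that it tends to \<open>H 0 = 1/2\<close>.
\<close>

text \<open>The Mellin transform is evaluated only at real \<open>s > 1\<close>, where every
  integrand and every summand is nonnegative. Tonelli then justifies all interchanges, and the
  finiteness of the moments is read off the result instead of being estimated beforehand. A power
  series with nonnegative coefficients is dominated on a complex disc by its value at a positive
  real point, so bounds for Gamma and zeta on the real axis control the growth in the whole plane.

  The growth exponent \<open>3/4\<close> lies above the true order \<open>1/2\<close> because
  \<open>ln\<close> is bounded crudely by a square root. What matters is that it is below 1: the
  zero count \<open>N = O(c N powr (3/4))\<close> then makes the reciprocals of the zeros summable,
  and the logarithm of the \<open>N\<close>-th quotient, bounded on a disc of radius
  \<open>c N\<close> by a sublinear function of \<open>c N\<close>, tends to 0 at every fixed point.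

  The converse direction uses only where the zeros of the product lie: they are the numbers
  \<open>s\<close> with \<open>s - s\<^sup>2\<close> equal to some
  \<open>\<bar>s\<^sub>\<nu>\<bar>\<^sup>2\<close>, and these are on the critical line.\<close>

section \<open>Theta transformation\<close>

text \<open>This is the characteristic function of the standard normal distribution after the
  substitution \<open>x = sqrt (2 * a) * u\<close>, which turns the density into a multiple of
  \<open>exp (- a * u\<^sup>2)\<close>.\<close>

lemma gaussian_cos_integral:
  fixes a b :: real
  assumes a: "a > 0"
  shows "integrable lborel (\<lambda>u. exp (- a * u\<^sup>2) * cos (b * u))"
    and "(LINT u|lborel. exp (- a * u\<^sup>2) * cos (b * u)) = sqrt (pi / a) * exp (- b\<^sup>2 / (4 * a))"
proof -
  define t where "t = b / sqrt (2 * a)"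
  define r where "r = sqrt (2 * a)"
  have r: "r > 0" "r\<^sup>2 = 2 * a" using a by (auto simp: r_def)
  have ch: "(LINT x|lborel. std_normal_density x *\<^sub>R iexp (t * x)) = complex_of_real (exp (- t\<^sup>2 / 2))"
    using fun_cong[OF char_std_normal_distribution, of t]
    by (simp add: char_def integral_density normal_density_nonneg)
  have int: "integrable lborel (\<lambda>x. std_normal_density x *\<^sub>R iexp (t * x))"
    by (rule Bochner_Integration.integrable_bound[OF integrable_std_normal_moment[of 0]])
       (auto simp: normal_density_nonneg)
  have hb: "has_bochner_integral lborel (\<lambda>x. Re (std_normal_density x *\<^sub>R iexp (t * x))) (exp (- t\<^sup>2 / 2))"
    using has_bochner_integral_bounded_linear[OF bounded_linear_Re has_bochner_integral_integrable[OF int]]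
    unfolding ch by simp
  have hb2: "has_bochner_integral lborel (\<lambda>x. std_normal_density x * cos (t * x)) (exp (- t\<^sup>2 / 2))"
    using hb by (simp add: Re_exp)
  have "has_bochner_integral lborel (\<lambda>u. std_normal_density (0 + r * u) * cos (t * (0 + r * u))) (exp (- t\<^sup>2 / 2) /\<^sub>R \<bar>r\<bar>)"
    using lborel_has_bochner_integral_real_affine_iff[where c=r and t=0, THEN iffD1, OF _ hb2] r by simp
  moreover have "t * r = b"
    using r by (simp add: t_def r_def[symmetric])
  ultimately have "has_bochner_integral lborel (\<lambda>u. std_normal_density (r * u) * cos (b * u)) (exp (- t\<^sup>2 / 2) / r)"
    using r by (simp add: inverse_eq_divide mult.assoc[symmetric])
  then have "has_bochner_integral lborel (\<lambda>u. sqrt (2 * pi) * (std_normal_density (r * u) * cos (b * u))) (sqrt (2 * pi) * (exp (- t\<^sup>2 / 2) / r))"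
    by (intro has_bochner_integral_mult_right) auto
  moreover have "sqrt (2 * pi) * (std_normal_density (r * u) * cos (b * u)) = exp (- a * u\<^sup>2) * cos (b * u)" for u
    by (simp add: std_normal_density_def power_mult_distrib r(2))
  moreover have "sqrt (2 * pi) * (exp (- t\<^sup>2 / 2) / r) = sqrt (pi / a) * exp (- b\<^sup>2 / (4 * a))"
  proof -
    have "sqrt (2 * pi) / r = sqrt (pi / a)"
      using a by (simp add: r_def real_sqrt_divide real_sqrt_mult)
    moreover have "- t\<^sup>2 / 2 = - b\<^sup>2 / (4 * a)"
      using a by (simp add: t_def power_divide)
    ultimately show ?thesis by (metis mult.commute times_divide_eq_right)
  qed
  ultimately have *: "has_bochner_integral lborel (\<lambda>u. exp (- a * u\<^sup>2) * cos (b * u)) (sqrt (pi / a) * exp (- b\<^sup>2 / (4 * a)))"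
    by simp
  show "integrable lborel (\<lambda>u. exp (- a * u\<^sup>2) * cos (b * u))"
    and "(LINT u|lborel. exp (- a * u\<^sup>2) * cos (b * u)) = sqrt (pi / a) * exp (- b\<^sup>2 / (4 * a))"
    using * by (simp_all add: has_bochner_integral_iff)
qed

text \<open>The half-integer end points are those of the interval tiled by
  \<open>[-1/2, 1/2]\<close> and its first \<open>N\<close> translates on either side.\<close>

lemma integral_symmetric_intervals_tendsto:
  fixes g :: "real \<Rightarrow> real"
  assumes g: "integrable lborel g"
  shows "(\<lambda>N. integral {- (real N + 1/2)..real N + 1/2} g) \<longlonglongrightarrow> (LINT u|lborel. g u)"
proof -
  have "(\<lambda>N. LINT u|lborel. indicator {- (real N + 1/2)..real N + 1/2} u *\<^sub>R g u) \<longlonglongrightarrow> (LINT u|lborel. g u)"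
  proof (rule integral_dominated_convergence[where w = "\<lambda>u. norm (g u)"])
    show "AE x in lborel. (\<lambda>N. indicator {- (real N + 1/2)..real N + 1/2} x *\<^sub>R g x) \<longlonglongrightarrow> g x"
    proof (rule AE_I2)
      fix x :: real
      have "\<forall>\<^sub>F N in sequentially. real N > \<bar>x\<bar>"
        using eventually_gt_at_top[of "nat \<lceil>\<bar>x\<bar>\<rceil>"] by eventually_elim linarith
      then have "\<forall>\<^sub>F N in sequentially. indicator {- (real N + 1/2)..real N + 1/2} x *\<^sub>R g x = g x"
        by eventually_elim (auto simp: indicator_def)
      then show "(\<lambda>N. indicator {- (real N + 1/2)..real N + 1/2} x *\<^sub>R g x) \<longlonglongrightarrow> g x"
        by (rule tendsto_eventually)
    qed
  qed (use g in \<open>auto simp: indicator_def split: if_splits\<close>)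
  moreover have "(LINT u|lborel. indicator {- (real N + 1/2)..real N + 1/2} u *\<^sub>R g u) = integral {- (real N + 1/2)..real N + 1/2} g" for N
    using set_borel_integral_eq_integral(2)[of "{- (real N + 1/2)..real N + 1/2}" g] g
    unfolding set_integrable_def set_lebesgue_integral_def
    by (simp add: integrable_mult_indicator del: real_scaleR_def minus_add_distrib)
  ultimately show ?thesis by simp
qed

text \<open>A Riemann-Lebesgue statement with a rate: integrating the sine by parts leaves boundary
  terms and an integral of \<open>deriv \<Phi>\<close>, all carrying a factor
  \<open>1 / M K\<close>.\<close>

lemma integral_sin_holomorphic_tendsto_0:
  fixes \<Phi> :: "complex \<Rightarrow> complex" and M :: "nat \<Rightarrow> real" and a b :: real
  assumes hol: "\<Phi> holomorphic_on S" and S: "open S" "complex_of_real ` {a..b} \<subseteq> S" and ab: "a \<le> b"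
    and M: "filterlim M at_top sequentially"
  shows "(\<lambda>K. integral {a..b} (\<lambda>t. \<Phi> (of_real t) * of_real (sin (M K * t)))) \<longlonglongrightarrow> 0"
proof -
  have cont: "continuous_on {a..b} (\<lambda>t. \<Phi> (of_real t))"
    by (rule continuous_on_compose2[OF holomorphic_on_imp_continuous_on[OF hol]])
       (use S in \<open>auto intro!: continuous_intros\<close>)
  have "deriv \<Phi> holomorphic_on S" using hol S by (simp add: holomorphic_deriv)
  from holomorphic_on_imp_continuous_on[OF this]
  have cont': "continuous_on {a..b} (\<lambda>t. deriv \<Phi> (of_real t))"
    by (rule continuous_on_compose2)
       (use S in \<open>auto intro!: continuous_intros\<close>)
  obtain B where B: "B > 0" "\<And>t. t \<in> {a..b} \<Longrightarrow> norm (\<Phi> (of_real t)) \<le> B"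
    using compact_imp_bounded[OF compact_continuous_image[OF cont compact_Icc]]
    unfolding bounded_pos by auto
  obtain B' where B': "B' > 0" "\<And>t. t \<in> {a..b} \<Longrightarrow> norm (deriv \<Phi> (of_real t)) \<le> B'"
    using compact_imp_bounded[OF compact_continuous_image[OF cont' compact_Icc]]
    unfolding bounded_pos by auto
  have bound: "norm (integral {a..b} (\<lambda>t. \<Phi> (of_real t) * of_real (sin (m * t)))) \<le> (2 * B + B' * (b - a)) / m"
    if m: "m > 0" for m
  proof -
    let ?P = "\<lambda>t. \<Phi> (of_real t) * of_real (- cos (m * t) / m)"
    have "((\<lambda>t. deriv \<Phi> (of_real t) * of_real (- cos (m * t) / m) + \<Phi> (of_real t) * of_real (sin (m * t)))
             has_integral (?P b - ?P a)) {a..b}"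
    proof (rule fundamental_theorem_of_calculus[OF ab])
      fix t assume t: "t \<in> {a..b}"
      have "((\<lambda>t. \<Phi> (of_real t)) has_vector_derivative deriv \<Phi> (of_real t)) (at t within {a..b})"
      proof -
        have "(\<Phi> has_field_derivative deriv \<Phi> (of_real t)) (at (of_real t))"
          using hol S t by (intro holomorphic_derivI) auto
        then show ?thesis
          by (metis has_vector_derivative_at_within has_vector_derivative_real_field)
      qed
      moreover have "((\<lambda>t. complex_of_real (- cos (m * t) / m)) has_vector_derivative of_real (sin (m * t))) (at t within {a..b})"
      proof -
        have "((\<lambda>t. - cos (m * t) / m) has_real_derivative sin (m * t)) (at t within {a..b})"
          using m by (auto intro!: derivative_eq_intros)
        then show ?thesis
          unfolding has_real_derivative_iff_has_vector_derivative 
          by (rule bounded_linear.has_vector_derivative[OF bounded_linear_of_real])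
      qed
      ultimately have "(?P has_vector_derivative (\<Phi> (of_real t) * of_real (sin (m * t)) + deriv \<Phi> (of_real t) * of_real (- cos (m * t) / m))) (at t within {a..b})"
        by (rule has_vector_derivative_mult)
      then show "(?P has_vector_derivative (deriv \<Phi> (of_real t) * of_real (- cos (m * t) / m) + \<Phi> (of_real t) * of_real (sin (m * t)))) (at t within {a..b})"
        by (simp only: add.commute)
    qed
    moreover have i1: "(\<lambda>t. deriv \<Phi> (of_real t) * of_real (- cos (m * t) / m)) integrable_on {a..b}"
      using m by (intro integrable_continuous_interval continuous_intros cont') auto
    ultimately have "((\<lambda>t. \<Phi> (of_real t) * of_real (sin (m * t))) has_integral
        (?P b - ?P a - integral {a..b} (\<lambda>t. deriv \<Phi> (of_real t) * of_real (- cos (m * t) / m)))) {a..b}"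
      using has_integral_diff[OF _ integrable_integral[OF i1]] by fastforce
    then have eq: "integral {a..b} (\<lambda>t. \<Phi> (of_real t) * of_real (sin (m * t))) =
        ?P b - ?P a - integral {a..b} (\<lambda>t. deriv \<Phi> (of_real t) * of_real (- cos (m * t) / m))"
      by (rule integral_unique)
    have Pb: "norm (?P t) \<le> B / m" if "t \<in> {a..b}" for t
    proof -
      have "norm (\<Phi> (of_real t)) * \<bar>cos (m * t)\<bar> \<le> B * 1"
        using B that by (intro mult_mono) auto
      then show ?thesis using m by (simp add: norm_mult norm_divide divide_right_mono)
    qed
    have "norm (integral {a..b} (\<lambda>t. deriv \<Phi> (of_real t) * of_real (- cos (m * t) / m))) \<le> B' / m * (b - a)"
    proof (rule integral_bound[OF ab])
      show "continuous_on {a..b} (\<lambda>t. deriv \<Phi> (complex_of_real t) * complex_of_real (- cos (m * t) / m))"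
        using m by (intro continuous_intros cont') auto
      fix t assume t: "t \<in> {a..b}"
      have "norm (deriv \<Phi> (of_real t)) * \<bar>cos (m * t)\<bar> \<le> B' * 1"
        using B' t by (intro mult_mono) auto
      then show "norm (deriv \<Phi> (complex_of_real t) * complex_of_real (- cos (m * t) / m)) \<le> B' / m"
        using m by (simp add: norm_mult norm_divide divide_right_mono)
    qed
    moreover have "norm (?P a) \<le> B / m" "norm (?P b) \<le> B / m" using Pb ab by auto
    ultimately have "norm (integral {a..b} (\<lambda>t. \<Phi> (of_real t) * of_real (sin (m * t)))) \<le> B / m + B / m + B' / m * (b - a)"
      unfolding eq using norm_triangle_ineq4[of "?P b" "?P a"]
        norm_triangle_ineq4[of "?P b - ?P a" "integral {a..b} (\<lambda>t. deriv \<Phi> (of_real t) * of_real (- cos (m * t) / m))"]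
      by linarith
    also have "\<dots> = (2 * B + B' * (b - a)) / m" by (simp add: add_divide_distrib)
    finally show ?thesis .
  qed
  have "(\<lambda>K. (2 * B + B' * (b - a)) / M K) \<longlonglongrightarrow> 0"
    by (intro tendsto_divide_0[OF tendsto_const] filterlim_at_top_imp_at_infinity M)
  then show ?thesis
  proof (rule Lim_null_comparison[rotated])
    show "\<forall>\<^sub>F K in sequentially. norm (integral {a..b} (\<lambda>t. \<Phi> (of_real t) * of_real (sin (M K * t)))) \<le> (2 * B + B' * (b - a)) / M K"
      using M[unfolded filterlim_at_top_dense, rule_format, of 0] by eventually_elim (rule bound)
  qed
qed

text \<open>The product-to-sum formula writes each summand as a difference of sines at consecutive
  odd multiples of \<open>pi * t\<close>, so the sum telescopes.\<close>

lemma sin_times_dirichlet_kernel: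
  fixes t :: real
  shows "sin (pi * t) * (1 + 2 * (\<Sum>k<K. cos (2 * pi * real (Suc k) * t))) = sin ((2 * real K + 1) * pi * t)"
proof (induction K)
  case (Suc K)
  have "sin (pi * t) * (1 + 2 * (\<Sum>k<Suc K. cos (2 * pi * real (Suc k) * t)))
      = sin ((2 * real K + 1) * pi * t) + 2 * (sin (pi * t) * cos (2 * pi * real (Suc K) * t))"
    using Suc by (simp add: algebra_simps)
  also have "2 * (sin (pi * t) * cos (2 * pi * real (Suc K) * t)) =
      sin (pi * t + 2 * pi * real (Suc K) * t) + sin (pi * t - 2 * pi * real (Suc K) * t)"
    by (simp only: sin_add sin_diff)
  also have "pi * t - 2 * pi * real (Suc K) * t = - ((2 * real K + 1) * pi * t)"
    by (simp add: algebra_simps)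
  also have "pi * t + 2 * pi * real (Suc K) * t = (2 * real (Suc K) + 1) * pi * t"
    by (simp add: algebra_simps)
  finally show ?case by simp
qed simp

lemma cos_integral_period:
  assumes "k > 0"
  shows "((\<lambda>t. cos (2 * pi * real k * t)) has_integral 0) {-1/2..1/2}"
proof -
  have "((\<lambda>t. cos (2 * pi * real k * t)) has_integral
      (sin (2 * pi * real k * (1/2)) / (2 * pi * real k) - sin (2 * pi * real k * (-1/2)) / (2 * pi * real k))) {-1/2..1/2}"
    using assms
    by (intro fundamental_theorem_of_calculus)
       (auto simp: has_real_derivative_iff_has_vector_derivative[symmetric] intro!: derivative_eq_intros)
  moreover have "sin (2 * pi * real k * (1/2)) = 0" using sin_npi[of k] by (simp add: mult.commute)
  moreover have "sin (2 * pi * real k * (-1/2)) = 0" using sin_npi[of k] by (simp add: mult.commute)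
  ultimately show ?thesis by simp
qed

text \<open>The linear term is the loss from shifting the Gaussian by a complex number of modulus at
  most \<open>R\<close>. Once \<open>n \<ge> 2 * R\<close> the quadratic term absorbs it and the
  exponent is at most \<open>- a * n\<close>.\<close>

lemma summable_gaussian_tail:
  fixes a R :: real
  assumes a: "a > 0"
  shows "summable (\<lambda>n. exp (- a * (real (Suc n))\<^sup>2 + 2 * a * real (Suc n) * R))"
proof (rule summable_comparison_test_ev)
  show "summable (\<lambda>n. exp (- a) ^ n)"
    using a by (intro summable_geometric) auto
  have "\<forall>\<^sub>F n in sequentially. real n \<ge> 2 * R"
    using eventually_ge_at_top[of "nat \<lceil>2 * R\<rceil>"] by eventually_elim linarith
  then show "\<forall>\<^sub>F n in sequentially. norm (exp (- a * (real (Suc n))\<^sup>2 + 2 * a * real (Suc n) * R)) \<le> exp (- a) ^ n"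
  proof eventually_elim
    case (elim n)
    have "real n * 1 \<le> real (Suc n) * (real (Suc n) - 2 * R)"
      using elim by (intro mult_mono) auto
    then have "a * real n \<le> a * (real (Suc n) * (real (Suc n) - 2 * R))"
      using a by simp
    also have "\<dots> = a * (real (Suc n))\<^sup>2 - 2 * a * real (Suc n) * R"
      by (simp add: algebra_simps power2_eq_square)
    finally have "- a * (real (Suc n))\<^sup>2 + 2 * a * real (Suc n) * R \<le> real n * (- a)"
      by (simp add: mult.commute)
    then show ?case unfolding exp_of_nat_mult[symmetric] by simp
  qed
qed

lemma Re_power2_shift_ge:
  fixes z :: complex and m R :: real
  assumes "norm z \<le> R" "m \<ge> 0"
  shows "Re ((z + of_real m)\<^sup>2) \<ge> m\<^sup>2 - 2 * m * R - R\<^sup>2"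
    and "Re ((z - of_real m)\<^sup>2) \<ge> m\<^sup>2 - 2 * m * R - R\<^sup>2"
proof -
  have R: "R \<ge> 0" using assms(1) norm_ge_zero[of z] by linarith
  have "\<bar>Im z\<bar> \<le> R" "\<bar>Re z\<bar> \<le> R" using assms abs_Im_le_cmod[of z] abs_Re_le_cmod[of z] by linarith+
  then have "(Im z)\<^sup>2 \<le> R\<^sup>2" "m * \<bar>Re z\<bar> \<le> m * R"
    using assms R by (auto simp: abs_le_square_iff[symmetric] intro: mult_left_mono)
  moreover have "m * Re z \<le> m * \<bar>Re z\<bar>" "- (m * Re z) \<le> m * \<bar>Re z\<bar>"
    using assms(2) by (metis abs_ge_self mult_left_mono, metis abs_ge_minus_self mult_left_mono mult_minus_right)
  moreover have "(Re z)\<^sup>2 \<ge> 0" by simp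
  moreover have "Re ((z + of_real m)\<^sup>2) = (Re z)\<^sup>2 - (Im z)\<^sup>2 + m\<^sup>2 + 2 * (m * Re z)"
    "Re ((z - of_real m)\<^sup>2) = (Re z)\<^sup>2 - (Im z)\<^sup>2 + m\<^sup>2 - 2 * (m * Re z)"
    "2 * m * R = 2 * (m * R)"
    by (simp_all add: power2_eq_square algebra_simps)
  ultimately show "Re ((z + of_real m)\<^sup>2) \<ge> m\<^sup>2 - 2 * m * R - R\<^sup>2"
    and "Re ((z - of_real m)\<^sup>2) \<ge> m\<^sup>2 - 2 * m * R - R\<^sup>2"
    by linarith+
qed

section \<open>The periodised Gaussian and its Poisson formula\<close>

context
  fixes a :: real
  assumes a: "a > 0"
begin

text \<open>The translates by \<open>n + 1\<close> and \<open>- (n + 1)\<close> are paired, so that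
  the sum over all integers becomes a series over the naturals whose partial sums run over symmetric
  ranges.\<close>

definition gpair :: "nat \<Rightarrow> complex \<Rightarrow> complex" where
  "gpair n z = exp (- of_real a * (z + of_nat (Suc n))\<^sup>2) + exp (- of_real a * (z - of_nat (Suc n))\<^sup>2)"

definition gpartial :: "nat \<Rightarrow> complex \<Rightarrow> complex" where
  "gpartial N z = exp (- of_real a * z\<^sup>2) + (\<Sum>n<N. gpair n z)"

definition gtheta :: "complex \<Rightarrow> complex" where
  "gtheta z = exp (- of_real a * z\<^sup>2) + (\<Sum>n. gpair n z)"

lemma norm_gpair_le:
  assumes "norm z \<le> R"
  shows "norm (gpair n z) \<le> 2 * exp (a * R\<^sup>2) * exp (- a * (real (Suc n))\<^sup>2 + 2 * a * real (Suc n) * R)"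
proof -
  have *: "exp (Re (- of_real a * y)) \<le> exp (a * R\<^sup>2) * exp (- a * (real (Suc n))\<^sup>2 + 2 * a * real (Suc n) * R)"
    if "Re y \<ge> (real (Suc n))\<^sup>2 - 2 * real (Suc n) * R - R\<^sup>2" for y
    using mult_left_mono[OF that, of a] a unfolding exp_add[symmetric]
    by (simp add: algebra_simps del: of_nat_Suc)
  have "norm (gpair n z) \<le> exp (Re (- of_real a * (z + of_nat (Suc n))\<^sup>2)) + exp (Re (- of_real a * (z - of_nat (Suc n))\<^sup>2))"
    unfolding gpair_def by (metis norm_exp_eq_Re norm_triangle_ineq)
  also have "\<dots> \<le> exp (a * R\<^sup>2) * exp (- a * (real (Suc n))\<^sup>2 + 2 * a * real (Suc n) * R) +
      exp (a * R\<^sup>2) * exp (- a * (real (Suc n))\<^sup>2 + 2 * a * real (Suc n) * R)"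
    by (intro add_mono *) (use Re_power2_shift_ge[OF assms, of "real (Suc n)"] in \<open>auto simp del: of_nat_Suc\<close>)
  finally show ?thesis by simp
qed

lemma gpartial_uniform_limit: "uniform_limit (cball 0 R) gpartial gtheta sequentially"
proof -
  have "uniform_limit (cball 0 R) (\<lambda>N z. \<Sum>n<N. gpair n z) (\<lambda>z. \<Sum>n. gpair n z) sequentially"
    by (rule Weierstrass_m_test[where M = "\<lambda>n. 2 * exp (a * R\<^sup>2) * exp (- a * (real (Suc n))\<^sup>2 + 2 * a * real (Suc n) * R)"])
       (use norm_gpair_le summable_gaussian_tail[OF a] in \<open>auto intro!: summable_mult simp del: of_nat_Suc\<close>)
  then show ?thesis
    unfolding gpartial_def[abs_def] gtheta_def[abs_def]
    by (intro uniform_limit_add uniform_limit_const) auto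
qed

lemma gtheta_holomorphic: "gtheta holomorphic_on UNIV"
proof (rule holomorphic_uniform_sequence)
  show "gpartial n holomorphic_on UNIV" for n
    unfolding gpartial_def[abs_def] gpair_def by (intro holomorphic_intros)
  show "\<exists>d>0. cball x d \<subseteq> UNIV \<and> uniform_limit (cball x d) gpartial gtheta sequentially" for x
  proof (intro exI conjI)
    show "uniform_limit (cball x 1) gpartial gtheta sequentially"
      by (rule uniform_limit_on_subset[OF gpartial_uniform_limit[of "norm x + 1"]])
         (simp add: cball_subset_cball_iff)
  qed auto
qed auto

lemma gtheta_0: "gtheta 0 = of_real (1 + 2 * (\<Sum>n. exp (- a * (real (Suc n))\<^sup>2)))"
proof -
  have s: "summable (\<lambda>n. exp (- a * (real (Suc n))\<^sup>2))"
    using summable_gaussian_tail[OF a, of 0] by simp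
  have "gpair n 0 = of_real (2 * exp (- a * (real (Suc n))\<^sup>2))" for n
    by (simp add: gpair_def exp_of_real[symmetric] del: of_nat_Suc)
  moreover have "(\<lambda>n. 2 * exp (- a * (real (Suc n))\<^sup>2)) sums (2 * (\<Sum>n. exp (- a * (real (Suc n))\<^sup>2)))"
    by (intro sums_mult summable_sums s)
  then have "(\<lambda>n. complex_of_real (2 * exp (- a * (real (Suc n))\<^sup>2))) sums of_real (2 * (\<Sum>n. exp (- a * (real (Suc n))\<^sup>2)))"
    by (rule sums_of_real)
  ultimately have "(\<lambda>n. gpair n 0) sums of_real (2 * (\<Sum>n. exp (- a * (real (Suc n))\<^sup>2)))"
    by presburger
  from sums_unique[OF this, symmetric] have "(\<Sum>n. gpair n 0) = of_real (2 * (\<Sum>n. exp (- a * (real (Suc n))\<^sup>2)))" .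
  then show ?thesis by (simp add: gtheta_def)
qed

text \<open>Unfolding: the cosine has period 1, so each translated Gaussian over
  \<open>[-1/2, 1/2]\<close> contributes the untranslated one over a translated unit interval, and
  these intervals tile the range on the right.\<close>

lemma gpartial_integral:
  "integral {-1/2..1/2} (\<lambda>t. gpartial N (of_real t) * of_real (cos (2 * pi * real k * t))) =
   of_real (integral {- (real N + 1/2)..real N + 1/2} (\<lambda>u. exp (- a * u\<^sup>2) * cos (2 * pi * real k * u)))"
proof (induction N)
  let ?f = "\<lambda>u. exp (- a * u\<^sup>2) * cos (2 * pi * real k * u)"
  have cont: "continuous_on S ?f" for S by (intro continuous_intros)
  note ii = integrable_continuous_interval[OF cont]
  have cr: "integral {l..r} (\<lambda>t. complex_of_real (f t)) = of_real (integral {l..r} f)" if "f integrable_on {l..r}" for f l r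
    using integral_linear[OF that bounded_linear_of_real[where 'a=complex]] by (simp add: o_def)
  have eqf: "exp (- of_real a * (of_real t)\<^sup>2) * of_real (cos (2 * pi * real k * t)) = complex_of_real (?f t)" for t
    by (simp add: exp_of_real[symmetric])
  {
    case 0
    show ?case
      by (simp only: gpartial_def lessThan_0 sum.empty add_0_right eqf cr[OF ii]) (simp del: of_real_mult)
  next
    case (Suc N)
    let ?m = "real (Suc N)"
    have per: "cos (2 * pi * real k * (t + ?m)) = cos (2 * pi * real k * t)"
              "cos (2 * pi * real k * (t - ?m)) = cos (2 * pi * real k * t)" for t
    proof -
      have "2 * pi * real k * (t + ?m) = 2 * pi * real k * t + 2 * pi * real_of_int (int (k * Suc N))"
           "2 * pi * real k * (t - ?m) = 2 * pi * real k * t - 2 * pi * real_of_int (int (k * Suc N))"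
        by (simp_all add: algebra_simps)
      then show "cos (2 * pi * real k * (t + ?m)) = cos (2 * pi * real k * t)"
              "cos (2 * pi * real k * (t - ?m)) = cos (2 * pi * real k * t)"
        by (simp_all only: cos_add cos_diff cos_int_2pin sin_int_2pin mult_1_right mult_zero_right add_0_right diff_0_right)
    qed
    have gp: "gpair N (of_real t) * of_real (cos (2 * pi * real k * t)) = complex_of_real (?f (t + ?m) + ?f (t - ?m))" for t
      unfolding per by (simp add: gpair_def exp_of_real[symmetric] algebra_simps)
    have c1: "continuous_on {-1/2..1/2} (\<lambda>t. gpartial N (of_real t) * of_real (cos (2 * pi * real k * t)))"
      unfolding gpartial_def gpair_def by (intro continuous_intros)
    have c2: "continuous_on {-1/2..1/2} (\<lambda>t. ?f (t + ?m) + ?f (t - ?m))"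
      by (intro continuous_intros)
    have "integral {-1/2..1/2} (\<lambda>t. gpartial (Suc N) (of_real t) * of_real (cos (2 * pi * real k * t))) =
       integral {-1/2..1/2} (\<lambda>t. gpartial N (of_real t) * of_real (cos (2 * pi * real k * t))
            + complex_of_real (?f (t + ?m) + ?f (t - ?m)))"
      unfolding gp[symmetric] by (simp add: gpartial_def algebra_simps)
    also have "\<dots> = integral {-1/2..1/2} (\<lambda>t. gpartial N (of_real t) * of_real (cos (2 * pi * real k * t)))
         + integral {-1/2..1/2} (\<lambda>t. complex_of_real (?f (t + ?m) + ?f (t - ?m)))"
      by (intro Henstock_Kurzweil_Integration.integral_add integrable_continuous_interval c1 continuous_on_of_real c2)
    also have "integral {-1/2..1/2} (\<lambda>t. complex_of_real (?f (t + ?m) + ?f (t - ?m))) =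
        of_real (integral {-1/2..1/2} (\<lambda>t. ?f (t + ?m) + ?f (t - ?m)))"
      by (intro cr integrable_continuous_interval c2)
    also have "integral {-1/2..1/2} (\<lambda>t. ?f (t + ?m) + ?f (t - ?m)) =
        integral {-1/2..1/2} (\<lambda>t. ?f (t + ?m)) + integral {-1/2..1/2} (\<lambda>t. ?f (t - ?m))"
      by (intro Henstock_Kurzweil_Integration.integral_add integrable_continuous_interval continuous_intros)
    also have "integral {-1/2..1/2} (\<lambda>t. ?f (t + ?m)) = integral {real N + 1/2..real N + 3/2} ?f"
      using integral_shift_real_ivl[of "-1/2 + ?m" ?m "1/2 + ?m" ?f]
      by (simp add: o_def algebra_simps)
    also have "integral {-1/2..1/2} (\<lambda>t. ?f (t - ?m)) = integral {- (real N + 3/2)..- (real N + 1/2)} ?f"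
      using integral_shift_real_ivl[of "-1/2 - ?m" "-?m" "1/2 - ?m" ?f]
      by (simp add: o_def algebra_simps)
    finally have "integral {-1/2..1/2} (\<lambda>t. gpartial (Suc N) (of_real t) * of_real (cos (2 * pi * real k * t))) =
       of_real (integral {- (real N + 1/2)..real N + 1/2} ?f + (integral {real N + 1/2..real N + 3/2} ?f + integral {- (real N + 3/2)..- (real N + 1/2)} ?f))"
      using Suc by (simp only: of_real_add)
    also have "integral {- (real N + 1/2)..real N + 1/2} ?f + (integral {real N + 1/2..real N + 3/2} ?f + integral {- (real N + 3/2)..- (real N + 1/2)} ?f)
       = integral {- (real N + 3/2)..real N + 3/2} ?f"
      using Henstock_Kurzweil_Integration.integral_combine[OF _ _ ii, of "- (real N + 3/2)" "- (real N + 1/2)" "real N + 1/2"]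
        Henstock_Kurzweil_Integration.integral_combine[OF _ _ ii, of "- (real N + 3/2)" "real N + 1/2" "real N + 3/2"]
      by simp
    also have "real N + 3/2 = real (Suc N) + 1/2" by simp
    finally show ?case .
  }
qed


text \<open>Uniform convergence passes the unfolded integrals to the limit on one side; on the other
  they exhaust the Gaussian cosine integral over the line with
  \<open>b = 2 * pi * k\<close>.\<close>

lemma gtheta_fourier_coeff:
  "integral {-1/2..1/2} (\<lambda>t. gtheta (of_real t) * of_real (cos (2 * pi * real k * t))) =
   of_real (sqrt (pi / a) * exp (- (pi\<^sup>2 / a) * (real k)\<^sup>2))"
proof (rule LIMSEQ_unique)
  have "uniform_limit {-1/2..1/2} (\<lambda>N t. gpartial N (of_real t) * of_real (cos (2 * pi * real k * t)))
         (\<lambda>t. gtheta (of_real t) * of_real (cos (2 * pi * real k * t))) sequentially"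
  proof (rule uniform_lim_mult)
    show "uniform_limit {-1/2..1/2} (\<lambda>N t. gpartial N (complex_of_real t)) (\<lambda>t. gtheta (complex_of_real t)) sequentially"
      by (rule uniform_limit_compose'[OF gpartial_uniform_limit[of 1]]) auto
    show "uniform_limit {-1/2..1/2} (\<lambda>N t. complex_of_real (cos (2 * pi * real k * t)))
        (\<lambda>t. complex_of_real (cos (2 * pi * real k * t))) sequentially"
      by (rule uniform_limit_const)
    have "continuous_on {-1/2..1/2} (\<lambda>t. gtheta (complex_of_real t))"
      by (rule continuous_on_compose2[OF holomorphic_on_imp_continuous_on[OF gtheta_holomorphic]])
         (auto intro!: continuous_intros)
    then show "bounded ((\<lambda>t. gtheta (complex_of_real t)) ` {-1/2..1/2})"
      by (intro compact_imp_bounded compact_continuous_image) auto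
    show "bounded ((\<lambda>t. complex_of_real (cos (2 * pi * real k * t))) ` {-1/2..1/2})"
      by (intro compact_imp_bounded compact_continuous_image continuous_intros) auto
  qed
  then obtain I J where IJ: "\<And>n. ((\<lambda>t. gpartial n (of_real t) * of_real (cos (2 * pi * real k * t))) has_integral I n) {-1/2..1/2}"
     "((\<lambda>t. gtheta (of_real t) * of_real (cos (2 * pi * real k * t))) has_integral J) {-1/2..1/2}" "I \<longlonglongrightarrow> J"
  proof (rule uniform_limit_integral)
    show "\<And>n. continuous_on {-1/2..1/2} (\<lambda>t. gpartial n (complex_of_real t) * complex_of_real (cos (2 * pi * real k * t)))"
      unfolding gpartial_def gpair_def by (intro continuous_intros)
  qed auto
  show "(\<lambda>N. integral {-1/2..1/2} (\<lambda>t. gpartial N (of_real t) * of_real (cos (2 * pi * real k * t)))) \<longlonglongrightarrow>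
      integral {-1/2..1/2} (\<lambda>t. gtheta (of_real t) * of_real (cos (2 * pi * real k * t)))"
    using IJ(3) unfolding integral_unique[OF IJ(1)] integral_unique[OF IJ(2)] .
  have "(\<lambda>N. integral {- (real N + 1/2)..real N + 1/2} (\<lambda>u. exp (- a * u\<^sup>2) * cos (2 * pi * real k * u)))
    \<longlonglongrightarrow> sqrt (pi / a) * exp (- (2 * pi * real k)\<^sup>2 / (4 * a))"
    using integral_symmetric_intervals_tendsto[OF gaussian_cos_integral(1)[OF a]]
    unfolding gaussian_cos_integral(2)[OF a] .
  also have "- (2 * pi * real k)\<^sup>2 / (4 * a) = - (pi\<^sup>2 / a) * (real k)\<^sup>2"
    by (simp add: power_mult_distrib)
  finally show "(\<lambda>N. integral {-1/2..1/2} (\<lambda>t. gpartial N (of_real t) * of_real (cos (2 * pi * real k * t)))) \<longlonglongrightarrow>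
      of_real (sqrt (pi / a) * exp (- (pi\<^sup>2 / a) * (real k)\<^sup>2))"
    unfolding gpartial_integral by (rule tendsto_of_real)
qed

text \<open>In the unit disc \<open>sin (pi * z)\<close> vanishes only at 0, and there to first
  order, so the zero of \<open>gtheta z - gtheta 0\<close> cancels it. In the proof \<open>Q\<close>
  and \<open>T\<close> are the two functions after removal of a factor \<open>z\<close>.\<close>

lemma gtheta_factor_sin:
  obtains \<Phi> where "\<Phi> holomorphic_on ball 0 1" "\<And>z. z \<in> ball 0 1 \<Longrightarrow> gtheta z - gtheta 0 = \<Phi> z * sin (of_real pi * z)"
proof -
  define s where "s = (\<lambda>z::complex. sin (of_real pi * z))"
  define Q where "Q = (\<lambda>z. if z = 0 then deriv gtheta 0 else (gtheta z - gtheta 0) / (z - 0))"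
  define T where "T = (\<lambda>z. if z = 0 then deriv s 0 else (s z - s 0) / (z - 0))"
  have Qh: "Q holomorphic_on UNIV"
    unfolding Q_def by (rule pole_lemma_open[OF gtheta_holomorphic open_UNIV])
  have Th: "T holomorphic_on UNIV"
    unfolding T_def by (rule pole_lemma_open) (auto simp: s_def intro!: holomorphic_intros)
  have ds: "deriv s 0 = of_real pi"
    unfolding s_def by (rule DERIV_imp_deriv) (auto intro!: derivative_eq_intros)
  have Tnz: "T z \<noteq> 0" if "z \<in> ball 0 1" for z
  proof (cases "z = 0")
    case False
    have "sin (of_real pi * z) \<noteq> 0"
    proof
      assume "sin (of_real pi * z) = 0"
      then obtain n :: int where "of_real pi * z = of_real (of_int n * pi)"
        by (auto simp: sin_eq_0)
      then have "z = of_int n" by simp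
      then show False using that False by simp
    qed
    then show ?thesis using False by (simp add: T_def s_def)
  qed (simp add: T_def ds)
  show ?thesis
  proof
    show "(\<lambda>z. Q z / T z) holomorphic_on ball 0 1"
      using Qh Th Tnz by (intro holomorphic_intros) (auto intro: holomorphic_on_subset)
    fix z :: complex assume z: "z \<in> ball 0 1"
    show "gtheta z - gtheta 0 = Q z / T z * sin (of_real pi * z)"
    proof (cases "z = 0")
      case False
      then show ?thesis using Tnz[OF z] by (simp add: T_def Q_def s_def)
    qed simp
  qed
qed

text \<open>The partial sums of the Fourier series of \<open>gtheta\<close> at \<open>0\<close> differ from \<open>gtheta 0\<close> by the integral of
  \<open>\<Phi>\<close> against a rapidly oscillating sine, because the Dirichlet kernel cancels the factor \<open>sin (pi t)\<close>.\<close>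
lemma gaussian_poisson:
  "1 + 2 * (\<Sum>n. exp (- a * (real (Suc n))\<^sup>2)) =
   sqrt (pi / a) * (1 + 2 * (\<Sum>n. exp (- (pi\<^sup>2 / a) * (real (Suc n))\<^sup>2)))"
proof -
  obtain \<Phi> where \<Phi>: "\<Phi> holomorphic_on ball 0 1"
      "\<And>z. z \<in> ball 0 1 \<Longrightarrow> gtheta z - gtheta 0 = \<Phi> z * sin (of_real pi * z)"
    using gtheta_factor_sin by blast
  define c where "c = (\<lambda>k. sqrt (pi / a) * exp (- (pi\<^sup>2 / a) * (real k)\<^sup>2))"
  define D where "D = (\<lambda>K t. 1 + 2 * (\<Sum>k<K. cos (2 * pi * real (Suc k) * t)))"
  have cg: "continuous_on {-1/2..1/2} (\<lambda>t. gtheta (complex_of_real t))"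
    by (rule continuous_on_compose2[OF holomorphic_on_imp_continuous_on[OF gtheta_holomorphic]])
       (auto intro!: continuous_intros)
  have fc: "((\<lambda>t. gtheta (of_real t) * of_real (cos (2 * pi * real k * t))) has_integral of_real (c k)) {-1/2..1/2}" for k
    unfolding c_def gtheta_fourier_coeff[symmetric]
    by (intro integrable_integral integrable_continuous_interval continuous_intros cg)
  have fc0: "((\<lambda>t. gtheta (of_real t)) has_integral of_real (c 0)) {-1/2..1/2}"
    using fc[of 0] by simp
  have D1: "((\<lambda>t. gtheta (of_real t) * of_real (D K t)) has_integral of_real (c 0 + 2 * (\<Sum>k<K. c (Suc k)))) {-1/2..1/2}" for K
  proof -
    have "((\<lambda>t. gtheta (of_real t) + 2 * (\<Sum>k<K. gtheta (of_real t) * of_real (cos (2 * pi * real (Suc k) * t)))) has_integral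
        (of_real (c 0) + 2 * (\<Sum>k<K. of_real (c (Suc k))))) {-1/2..1/2}"
      by (intro has_integral_add fc0 has_integral_mult_right has_integral_sum fc) auto
    then show ?thesis by (simp add: D_def sum_distrib_left algebra_simps)
  qed
  have D2: "((\<lambda>t. gtheta 0 * complex_of_real (D K t)) has_integral gtheta 0) {-1/2..1/2}" for K
  proof -
    have "((\<lambda>t. 1 + 2 * (\<Sum>k<K. cos (2 * pi * real (Suc k) * t))) has_integral
        (1 + 2 * (\<Sum>k<K. 0))) {-1/2..1/2}"
      using has_integral_const_real[of "1::real" "-1/2" "1/2"]
      by (intro has_integral_add has_integral_mult_right has_integral_sum cos_integral_period) auto
    then have "(D K has_integral 1) {-1/2..1/2}" by (simp add: D_def[abs_def])
    from has_integral_mult_right[OF has_integral_linear[OF this bounded_linear_of_real[where 'a=complex]], of "gtheta 0"]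
    show ?thesis by (simp add: o_def)
  qed
  have "integral {-1/2..1/2} (\<lambda>t. \<Phi> (of_real t) * of_real (sin ((2 * real K + 1) * pi * t)))
      = of_real (c 0 + 2 * (\<Sum>k<K. c (Suc k))) - gtheta 0" for K
  proof (rule integral_unique)
    have "\<Phi> (of_real t) * of_real (sin ((2 * real K + 1) * pi * t)) =
       gtheta (of_real t) * of_real (D K t) - gtheta 0 * complex_of_real (D K t)" if "t \<in> {-1/2..1/2}" for t
    proof -
      have "\<Phi> (of_real t) * of_real (sin ((2 * real K + 1) * pi * t)) =
          \<Phi> (of_real t) * sin (of_real pi * of_real t) * of_real (D K t)"
        unfolding sin_times_dirichlet_kernel[symmetric] D_def
        by (simp add: sin_of_real[symmetric] del: sin_of_real)
      also have "\<Phi> (of_real t) * sin (of_real pi * of_real t) = gtheta (of_real t) - gtheta 0"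
        using \<Phi>(2)[of "of_real t"] that by auto
      finally show ?thesis by (simp add: algebra_simps)
    qed
    then show "((\<lambda>t. \<Phi> (of_real t) * of_real (sin ((2 * real K + 1) * pi * t))) has_integral
      (of_real (c 0 + 2 * (\<Sum>k<K. c (Suc k))) - gtheta 0)) {-1/2..1/2}"
      using has_integral_diff[OF D1[of K] D2[of K]] by (subst has_integral_cong) auto
  qed
  moreover have "(\<lambda>K. integral {-1/2..1/2} (\<lambda>t. \<Phi> (of_real t) * of_real (sin ((2 * real K + 1) * pi * t)))) \<longlonglongrightarrow> 0"
  proof (rule integral_sin_holomorphic_tendsto_0[OF \<Phi>(1)])
    show "filterlim (\<lambda>K. (2 * real K + 1) * pi) at_top sequentially"
      by real_asymp
  qed auto
  ultimately have "(\<lambda>K. of_real (c 0 + 2 * (\<Sum>k<K. c (Suc k))) - gtheta 0) \<longlonglongrightarrow> 0" by simp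
  then have l1: "(\<lambda>K. of_real (c 0 + 2 * (\<Sum>k<K. c (Suc k)))) \<longlonglongrightarrow> gtheta 0"
    by (simp only: LIM_zero_iff)
  have "pi\<^sup>2 / a > 0" using a by simp
  then have s: "summable (\<lambda>n. exp (- (pi\<^sup>2 / a) * (real (Suc n))\<^sup>2))"
    using summable_gaussian_tail[of "pi\<^sup>2 / a" 0] by simp
  have "(\<lambda>k. c (Suc k)) sums (sqrt (pi / a) * (\<Sum>n. exp (- (pi\<^sup>2 / a) * (real (Suc n))\<^sup>2)))"
    unfolding c_def by (intro sums_mult summable_sums s)
  then have "(\<lambda>K. c 0 + 2 * (\<Sum>k<K. c (Suc k))) \<longlonglongrightarrow> c 0 + 2 * (sqrt (pi / a) * (\<Sum>n. exp (- (pi\<^sup>2 / a) * (real (Suc n))\<^sup>2)))"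
    unfolding sums_def by (intro tendsto_intros)
  from tendsto_of_real[OF this] l1 have "gtheta 0 = of_real (c 0 + 2 * (sqrt (pi / a) * (\<Sum>n. exp (- (pi\<^sup>2 / a) * (real (Suc n))\<^sup>2))))"
    using LIMSEQ_unique by blast
  then show ?thesis
    unfolding gtheta_0 of_real_eq_iff by (simp add: c_def algebra_simps)
qed

end

section \<open>Mellin transform of the theta series\<close>

text \<open>The substitution is made on compact intervals, whose images under \<open>exp\<close>
  exhaust the positive half-line; monotone convergence does the rest.\<close>

lemma nn_integral_exp_substitution:
  fixes f :: "real \<Rightarrow> ennreal"
  assumes [measurable]: "f \<in> borel_measurable borel"
  shows "(\<integral>\<^sup>+t. f t * indicator {0<..} t \<partial>lborel) = (\<integral>\<^sup>+y. f (exp y) * ennreal (exp y) \<partial>lborel)"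
proof (rule LIMSEQ_unique)
  let ?I = "\<lambda>N::nat. {- real (Suc N)..real (Suc N)}"
  let ?E = "\<lambda>N::nat. {exp (- real (Suc N))..exp (real (Suc N))}"
  have eq: "(\<integral>\<^sup>+t. f t * indicator (?E N) t \<partial>lborel) = (\<integral>\<^sup>+y. f (exp y) * ennreal (exp y) * indicator (?I N) y \<partial>lborel)" for N
    by (rule nn_integral_substitution_aux) (auto intro!: continuous_intros derivative_eq_intros)
  show "(\<lambda>N. \<integral>\<^sup>+t. f t * indicator (?E N) t \<partial>lborel) \<longlonglongrightarrow> (\<integral>\<^sup>+t. f t * indicator {0<..} t \<partial>lborel)"
  proof (rule nn_integral_LIMSEQ)
    show "incseq (\<lambda>N t. f t * indicator (?E N) t)"
    proof (intro incseq_SucI le_funI mult_left_mono)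
      fix N t show "(indicator (?E N) t :: ennreal) \<le> indicator (?E (Suc N)) t"
        by (auto simp: indicator_def intro: order_trans[of "exp (- 2 - real N)" "exp (- 1 - real N)"] order_trans[of _ "exp (1 + real N)"])
    qed auto
    show "(\<lambda>N. f t * indicator (?E N) t) \<longlonglongrightarrow> f t * indicator {0<..} t" for t
    proof (cases "t > 0")
      case True
      have "\<forall>\<^sub>F N in sequentially. \<bar>ln t\<bar> \<le> real N"
        using eventually_ge_at_top[of "nat \<lceil>\<bar>ln t\<bar>\<rceil>"] by eventually_elim linarith
      then have "\<forall>\<^sub>F N in sequentially. f t * indicator (?E N) t = f t * indicator {0<..} t"
      proof eventually_elim
        case (elim N)
        then have "- real (Suc N) \<le> ln t" "ln t \<le> real (Suc N)" by auto
        then have "exp (- real (Suc N)) \<le> t" "t \<le> exp (real (Suc N))"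
          using True by (metis exp_le_cancel_iff exp_ln)+
        then show ?case using True by simp
      qed
      then show ?thesis by (rule tendsto_eventually)
    next
      case False
      then have "t \<notin> ?E N" for N using exp_gt_zero[of "- real (Suc N)"] by (auto simp del: exp_gt_zero)
      then show ?thesis using False by simp
    qed
  qed measurable
  show "(\<lambda>N. \<integral>\<^sup>+t. f t * indicator (?E N) t \<partial>lborel) \<longlonglongrightarrow> (\<integral>\<^sup>+y. f (exp y) * ennreal (exp y) \<partial>lborel)"
    unfolding eq
  proof (rule nn_integral_LIMSEQ)
    show "incseq (\<lambda>N y. f (exp y) * ennreal (exp y) * indicator (?I N) y)"
      by (intro incseq_SucI le_funI mult_left_mono) (auto simp: indicator_def)
    show "(\<lambda>N. f (exp y) * ennreal (exp y) * indicator (?I N) y) \<longlonglongrightarrow> f (exp y) * ennreal (exp y)" for y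
    proof -
      have "\<forall>\<^sub>F N in sequentially. \<bar>y\<bar> \<le> real N"
        using eventually_ge_at_top[of "nat \<lceil>\<bar>y\<bar>\<rceil>"] by eventually_elim linarith
      then have "\<forall>\<^sub>F N in sequentially. f (exp y) * ennreal (exp y) * indicator (?I N) y = f (exp y) * ennreal (exp y)"
        by eventually_elim (auto simp: indicator_def)
      then show ?thesis by (rule tendsto_eventually)
    qed
  qed measurable
qed

text \<open>Euler's integral for \<open>Gamma (s / 2)\<close> with
  \<open>t = c * exp (2 * y)\<close>; the leading 2 is the Jacobian. The proof substitutes
  \<open>exp\<close> first and then the affine map \<open>ln c + 2 * y\<close>.\<close>

lemma nn_integral_mellin_gaussian:
  fixes s c :: real
  assumes s: "s > 0" and c: "c > 0"
  shows "(\<integral>\<^sup>+y. ennreal (2 * exp (s * y) * exp (- c * exp (2 * y))) \<partial>lborel) = ennreal (c powr (- s / 2) * Gamma (s / 2))"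
proof -
  have "ennreal (Gamma (s / 2)) = (\<integral>\<^sup>+t. ennreal (indicator {0..} t * t powr (s / 2 - 1) / exp t) \<partial>lborel)"
    using s Gamma_conv_nn_integral_real[of "s / 2"] by simp
  also have "\<dots> = (\<integral>\<^sup>+t. ennreal (t powr (s / 2 - 1) / exp t) * indicator {0<..} t \<partial>lborel)"
    by (intro nn_integral_cong) (auto simp: indicator_def)
  also have "\<dots> = (\<integral>\<^sup>+y. ennreal (exp y powr (s / 2 - 1) / exp (exp y)) * ennreal (exp y) \<partial>lborel)"
    by (rule nn_integral_exp_substitution) measurable
  also have "\<dots> = (\<integral>\<^sup>+y. ennreal (exp (s / 2 * y) * exp (- exp y)) \<partial>lborel)"
  proof (intro nn_integral_cong)
    fix y :: real
    have "exp y powr (s / 2 - 1) / exp (exp y) * exp y = exp ((s / 2 - 1) * y + y) * exp (- exp y)"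
    proof -
      have "exp y powr (s / 2 - 1) = exp ((s / 2 - 1) * y)" by (simp add: powr_def)
      then show ?thesis unfolding exp_add exp_minus[of "exp y"] divide_inverse by (simp only: mult_ac)
    qed
    also have "(s / 2 - 1) * y + y = s / 2 * y" by (simp add: algebra_simps)
    finally show "ennreal (exp y powr (s / 2 - 1) / exp (exp y)) * ennreal (exp y) = ennreal (exp (s / 2 * y) * exp (- exp y))"
      by (simp add: ennreal_mult[symmetric])
  qed
  also have "\<dots> = ennreal \<bar>2\<bar> * (\<integral>\<^sup>+y. ennreal (exp (s / 2 * (ln c + 2 * y)) * exp (- exp (ln c + 2 * y))) \<partial>lborel)"
    by (rule nn_integral_real_affine) auto
  also have "\<dots> = (\<integral>\<^sup>+y. ennreal 2 * ennreal (exp (s / 2 * (ln c + 2 * y)) * exp (- exp (ln c + 2 * y))) \<partial>lborel)"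
    by (subst nn_integral_cmult) auto
  also have "\<dots> = (\<integral>\<^sup>+y. ennreal (c powr (s / 2)) * ennreal (2 * exp (s * y) * exp (- c * exp (2 * y))) \<partial>lborel)"
  proof (intro nn_integral_cong)
    fix y
    have "2 * (exp (s / 2 * (ln c + 2 * y)) * exp (- exp (ln c + 2 * y))) = c powr (s / 2) * (2 * exp (s * y) * exp (- c * exp (2 * y)))"
      using c by (simp add: powr_def exp_add distrib_left)
    then show "ennreal 2 * ennreal (exp (s / 2 * (ln c + 2 * y)) * exp (- exp (ln c + 2 * y))) =
        ennreal (c powr (s / 2)) * ennreal (2 * exp (s * y) * exp (- c * exp (2 * y)))"
      by (simp add: ennreal_mult[symmetric] del: ennreal_numeral)
  qed
  also have "\<dots> = ennreal (c powr (s / 2)) * (\<integral>\<^sup>+y. ennreal (2 * exp (s * y) * exp (- c * exp (2 * y))) \<partial>lborel)"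
    by (subst nn_integral_cmult) auto
  finally have "ennreal (c powr (- s / 2)) * ennreal (Gamma (s / 2)) =
     ennreal (c powr (- s / 2)) * (ennreal (c powr (s / 2)) * (\<integral>\<^sup>+y. ennreal (2 * exp (s * y) * exp (- c * exp (2 * y))) \<partial>lborel))"
    by simp
  also have "\<dots> = ennreal (c powr (- s / 2) * c powr (s / 2)) * (\<integral>\<^sup>+y. ennreal (2 * exp (s * y) * exp (- c * exp (2 * y))) \<partial>lborel)"
    by (simp add: ennreal_mult mult.assoc)
  also have "c powr (- s / 2) * c powr (s / 2) = 1"
    using c by (simp add: powr_add[symmetric])
  finally show ?thesis using s by (simp add: ennreal_mult Gamma_real_nonneg)
qed

text \<open>Riemann's psi function: the theta series over all integers is
  \<open>1 + 2 * jacobi_psi q\<close>.\<close>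

definition jacobi_psi :: "real \<Rightarrow> real" where
  "jacobi_psi q = (\<Sum>n. exp (- pi * (real (Suc n))\<^sup>2 * q))"

lemma jacobi_psi_sums:
  assumes "q > 0"
  shows "(\<lambda>n. exp (- pi * (real (Suc n))\<^sup>2 * q)) sums jacobi_psi q"
proof -
  have "summable (\<lambda>n. exp (- (pi * q) * (real (Suc n))\<^sup>2))"
    using summable_gaussian_tail[of "pi * q" 0] assms by simp
  moreover have "- (pi * q) * (real (Suc n))\<^sup>2 = - pi * (real (Suc n))\<^sup>2 * q" for n by simp
  ultimately show ?thesis unfolding jacobi_psi_def by (simp only: summable_sums)
qed

lemma jacobi_psi_nonneg: "q > 0 \<Longrightarrow> jacobi_psi q \<ge> 0"
  by (rule sums_le[OF _ sums_zero jacobi_psi_sums]) auto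

lemma jacobi_psi_measurable [measurable]: "jacobi_psi \<in> borel_measurable borel"
  unfolding jacobi_psi_def by measurable

text \<open>The Poisson formula at \<open>a = pi * exp (- 2 * y)\<close>, where
  \<open>sqrt (pi / a) = exp y\<close> and \<open>pi\<^sup>2 / a = pi * exp (2 * y)\<close>.\<close>

lemma jacobi_psi_exp_minus:
  "2 * jacobi_psi (exp (- 2 * y)) = exp y - 1 + 2 * exp y * jacobi_psi (exp (2 * y))"
proof -
  let ?x = "exp (- 2 * y)"
  have "1 + 2 * (\<Sum>n. exp (- (pi * ?x) * (real (Suc n))\<^sup>2)) =
      sqrt (pi / (pi * ?x)) * (1 + 2 * (\<Sum>n. exp (- (pi\<^sup>2 / (pi * ?x)) * (real (Suc n))\<^sup>2)))"
    by (rule gaussian_poisson) auto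
  moreover have "pi / (pi * ?x) = (exp y)\<^sup>2" "pi\<^sup>2 / (pi * ?x) = pi * exp (2 * y)"
    by (simp_all add: exp_minus power2_eq_square mult_exp_exp field_simps)
  moreover have "(\<Sum>n. exp (- (pi * ?x) * (real (Suc n))\<^sup>2)) = jacobi_psi ?x"
    "(\<Sum>n. exp (- (pi * exp (2 * y)) * (real (Suc n))\<^sup>2)) = jacobi_psi (exp (2 * y))"
    unfolding jacobi_psi_def by (simp_all add: mult_ac)
  ultimately have "1 + 2 * jacobi_psi ?x = exp y * (1 + 2 * jacobi_psi (exp (2 * y)))"
    by (simp only: real_sqrt_abs) simp
  then show ?thesis by (simp add: algebra_simps)
qed

section \<open>Zeta at real arguments as a Mellin transform\<close>

definition real_zeta :: "real \<Rightarrow> real" where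
  "real_zeta s = (\<Sum>n. 1 / real (Suc n) powr s)"

lemma real_zeta_sums: "s > 1 \<Longrightarrow> (\<lambda>n. 1 / real (Suc n) powr s) sums real_zeta s"
proof -
  assume "s > 1"
  then have "summable (\<lambda>n. real n powr - s)" by (simp add: summable_real_powr_iff)
  then have "summable (\<lambda>n. real (Suc n) powr - s)" by (subst summable_Suc_iff)
  then show ?thesis unfolding real_zeta_def powr_minus_divide by (rule summable_sums)
qed

text \<open>Termwise use of the Gaussian case with \<open>c = pi * (n + 1)\<^sup>2\<close>, whose
  power \<open>- s / 2\<close> supplies the Dirichlet term
  \<open>1 / (n + 1) powr s\<close>.\<close>

lemma nn_integral_mellin_jacobi_psi:
  assumes s: "s > 1"
  shows "(\<integral>\<^sup>+y. ennreal (2 * exp (s * y) * jacobi_psi (exp (2 * y))) \<partial>lborel) =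
      ennreal (pi powr (- s / 2) * Gamma (s / 2) * real_zeta s)"
proof -
  have "(\<integral>\<^sup>+y. ennreal (2 * exp (s * y) * jacobi_psi (exp (2 * y))) \<partial>lborel) =
      (\<integral>\<^sup>+y. (\<Sum>n. ennreal (2 * exp (s * y) * exp (- (pi * (real (Suc n))\<^sup>2) * exp (2 * y)))) \<partial>lborel)"
  proof (intro nn_integral_cong)
    fix y
    have "(\<lambda>n. 2 * exp (s * y) * exp (- pi * (real (Suc n))\<^sup>2 * exp (2 * y))) sums (2 * exp (s * y) * jacobi_psi (exp (2 * y)))"
      by (intro sums_mult jacobi_psi_sums) auto
    then show "ennreal (2 * exp (s * y) * jacobi_psi (exp (2 * y))) =
      (\<Sum>n. ennreal (2 * exp (s * y) * exp (- (pi * (real (Suc n))\<^sup>2) * exp (2 * y))))"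
      by (subst suminf_ennreal2) (auto simp: sums_iff)
  qed
  also have "\<dots> = (\<Sum>n. \<integral>\<^sup>+y. ennreal (2 * exp (s * y) * exp (- (pi * (real (Suc n))\<^sup>2) * exp (2 * y))) \<partial>lborel)"
    by (rule nn_integral_suminf) auto
  also have "\<dots> = (\<Sum>n. ennreal ((pi * (real (Suc n))\<^sup>2) powr (- s / 2) * Gamma (s / 2)))"
    using s by (subst nn_integral_mellin_gaussian) auto
  also have "(\<lambda>n. (pi * (real (Suc n))\<^sup>2) powr (- s / 2) * Gamma (s / 2)) = (\<lambda>n. pi powr (- s / 2) * Gamma (s / 2) * (1 / real (Suc n) powr s))"
  proof
    fix n
    have "((real (Suc n))\<^sup>2) powr (- s / 2) = real (Suc n) powr (2 * (- s / 2))"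
      by (simp only: powr_powr[symmetric] powr_numeral of_nat_0_less_iff zero_less_Suc)
    also have "\<dots> = 1 / real (Suc n) powr s" by (simp add: powr_minus_divide)
    finally show "(pi * (real (Suc n))\<^sup>2) powr (- s / 2) * Gamma (s / 2) = pi powr (- s / 2) * Gamma (s / 2) * (1 / real (Suc n) powr s)"
      by (subst powr_mult) (simp_all del: of_nat_Suc)
  qed
  also have "(\<Sum>n. ennreal (pi powr (- s / 2) * Gamma (s / 2) * (1 / real (Suc n) powr s))) = ennreal (pi powr (- s / 2) * Gamma (s / 2) * real_zeta s)"
  proof -
    have "(\<lambda>n. pi powr (- s / 2) * Gamma (s / 2) * (1 / real (Suc n) powr s)) sums (pi powr (- s / 2) * Gamma (s / 2) * real_zeta s)"
      by (intro sums_mult real_zeta_sums s)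
    then show ?thesis
      using s by (subst suminf_ennreal2) (auto simp: sums_iff intro!: mult_nonneg_nonneg Gamma_real_nonneg)
  qed
  finally show ?thesis .
qed

text \<open>The theta integral is taken in the logarithmic variable \<open>y\<close>, where the argument of the theta series
  is \<open>exp (2 * y)\<close>; the functional equation is then the reflection \<open>y \<mapsto> - y\<close>.\<close>
definition xi_kernel :: "real \<Rightarrow> real" where
  "xi_kernel y = 4 * exp (y / 2) * jacobi_psi (exp (2 * y))"

lemma xi_kernel_nonneg: "xi_kernel y \<ge> 0"
  by (simp add: xi_kernel_def jacobi_psi_nonneg)

lemma xi_kernel_measurable [measurable]: "xi_kernel \<in> borel_measurable borel"
  unfolding xi_kernel_def by measurable

text \<open>This is the contribution of the elementary part \<open>exp y - 1\<close> of the theta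
  transformation; it is the source of the poles of the completed zeta function at 0 and 1.\<close>

lemma nn_integral_exp_diff:
  fixes s :: real
  assumes "s > 1"
  shows "(\<integral>\<^sup>+y. ennreal (exp ((1 - s) * y) - exp (- s * y)) * indicator {0..} y \<partial>lborel) = ennreal (1 / (s - 1) - 1 / s)"
proof -
  let ?F = "\<lambda>y. exp ((1 - s) * y) / (1 - s) + exp (- s * y) / s"
  have "(\<integral>\<^sup>+y. ennreal (exp ((1 - s) * y) - exp (- s * y)) * indicator {0..} y \<partial>lborel) = ennreal (0 - ?F 0)"
  proof (rule nn_integral_FTC_atLeast)
    show "(?F has_real_derivative exp ((1 - s) * y) - exp (- s * y)) (at y)" for y
      using assms by (auto intro!: derivative_eq_intros)
    show "0 \<le> exp ((1 - s) * y) - exp (- s * y)" if "0 \<le> y" for y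
      using that by (simp add: algebra_simps)
    have "((\<lambda>y. exp (c * y)) \<longlongrightarrow> 0) at_top" if "c < 0" for c :: real
      by (rule filterlim_compose[OF exp_at_bot filterlim_tendsto_neg_mult_at_bot[OF tendsto_const that filterlim_ident]])
    from this[of "1 - s"] this[of "- s"] assms
    have "(?F \<longlongrightarrow> 0 / (1 - s) + 0 / s) at_top" by (intro tendsto_intros) auto
    then show "(?F \<longlongrightarrow> 0) at_top" by simp
  qed measurable
  also have "0 - ?F 0 = 1 / (s - 1) - 1 / s" using assms by (simp add: field_simps)
  finally show ?thesis .
qed

lemma borel_measurable_cosh_cmult [measurable]: "(\<lambda>y::real. cosh (c * y)) \<in> borel_measurable borel"
  by (intro borel_measurable_continuous_onI continuous_intros)

text \<open>The half-line \<open>y < 0\<close> is reflected and rewritten by the theta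
  transformation. The terms with \<open>exp (s * y)\<close> and \<open>exp ((1 - s) * y)\<close>
  then share the factor \<open>exp (y / 2)\<close> and combine to a hyperbolic cosine. The
  elementary part stands as a summand on the left so that no subtraction of extended reals
  occurs.\<close>

lemma nn_integral_xi_kernel_cosh:
  assumes s: "s > 1"
  shows "(\<integral>\<^sup>+y. ennreal (xi_kernel y * cosh ((s - 1/2) * y)) * indicator {0..} y \<partial>lborel) + ennreal (1 / (s - 1) - 1 / s)
       = ennreal (pi powr (- s / 2) * Gamma (s / 2) * real_zeta s)"
proof -
  let ?g = "\<lambda>y. 2 * exp (s * y) * jacobi_psi (exp (2 * y))"
  have "ennreal (pi powr (- s / 2) * Gamma (s / 2) * real_zeta s) = (\<integral>\<^sup>+y. ennreal (?g y) \<partial>lborel)"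
    by (rule nn_integral_mellin_jacobi_psi[OF s, symmetric])
  also have "\<dots> = (\<integral>\<^sup>+y. ennreal (?g y) * indicator {0..} y + ennreal (?g y) * indicator {..<0} y \<partial>lborel)"
    by (intro nn_integral_cong) (auto simp: indicator_def)
  also have "\<dots> = (\<integral>\<^sup>+y. ennreal (?g y) * indicator {0..} y \<partial>lborel) + (\<integral>\<^sup>+y. ennreal (?g y) * indicator {..<0} y \<partial>lborel)"
    by (rule nn_integral_add) auto
  also have "(\<integral>\<^sup>+y. ennreal (?g y) * indicator {..<0} y \<partial>lborel) = ennreal \<bar>-1\<bar> * (\<integral>\<^sup>+y. ennreal (?g (0 + (-1) * y)) * indicator {..<0} (0 + (-1) * y) \<partial>lborel)"
    by (rule nn_integral_real_affine) auto
  also have "\<dots> = (\<integral>\<^sup>+y. ennreal (?g (- y)) * indicator {..<0} (- y) \<partial>lborel)" by simp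
  \<comment> \<open>Reflection gives the indicator of \<open>y > 0\<close>; it differs from that of
    \<open>y \<ge> 0\<close> only on the null set \<open>{0}\<close>.\<close>
  also have "\<dots> = (\<integral>\<^sup>+y. ennreal (?g (- y)) * indicator {0..} y \<partial>lborel)"
    by (intro nn_integral_cong_AE, rule AE_mp[OF AE_lborel_singleton[of 0]]) (auto simp: indicator_def intro!: AE_I2)
  also have "(\<integral>\<^sup>+y. ennreal (?g y) * indicator {0..} y \<partial>lborel) + \<dots> =
      (\<integral>\<^sup>+y. ennreal (?g y) * indicator {0..} y + ennreal (?g (- y)) * indicator {0..} y \<partial>lborel)"
    by (rule nn_integral_add[symmetric]) auto
  also have "\<dots> = (\<integral>\<^sup>+y. ennreal (xi_kernel y * cosh ((s - 1/2) * y)) * indicator {0..} y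
       + ennreal (exp ((1 - s) * y) - exp (- s * y)) * indicator {0..} y \<partial>lborel)"
  proof (intro nn_integral_cong)
    fix y :: real
    have "?g (- y) = exp (- s * y) * (2 * jacobi_psi (exp (- 2 * y)))" by simp
    also have "\<dots> = exp (- s * y) * exp y - exp (- s * y) + 2 * (exp (- s * y) * exp y) * jacobi_psi (exp (2 * y))"
      unfolding jacobi_psi_exp_minus by (simp add: algebra_simps)
    also have "exp (- s * y) * exp y = exp ((1 - s) * y)" by (simp add: mult_exp_exp algebra_simps)
    finally have gm: "?g (- y) = exp ((1 - s) * y) - exp (- s * y) + 2 * exp ((1 - s) * y) * jacobi_psi (exp (2 * y))" .
    have e1: "exp (s * y) = exp (y / 2) * exp ((s - 1/2) * y)"
      unfolding mult_exp_exp by (simp add: algebra_simps)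
    have e2: "exp ((1 - s) * y) = exp (y / 2) * exp (- ((s - 1/2) * y))"
      unfolding mult_exp_exp by (simp add: algebra_simps)
    have eq: "?g y + 2 * exp ((1 - s) * y) * jacobi_psi (exp (2 * y)) = xi_kernel y * cosh ((s - 1/2) * y)"
      unfolding xi_kernel_def cosh_def e1 e2 scaleR_conv_of_real of_real_eq_id id_apply by algebra
    have nn: "jacobi_psi (exp (2 * y)) \<ge> 0" "jacobi_psi (exp (2 * (- y))) \<ge> 0" by (auto intro: jacobi_psi_nonneg)
    show "ennreal (?g y) * indicator {0..} y + ennreal (?g (- y)) * indicator {0..} y =
       ennreal (xi_kernel y * cosh ((s - 1/2) * y)) * indicator {0..} y
       + ennreal (exp ((1 - s) * y) - exp (- s * y)) * indicator {0..} y"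
    proof (cases "y \<ge> 0")
      case True
      have "ennreal (?g y) + ennreal (?g (- y)) = ennreal (?g y + ?g (- y))"
        using nn by (intro ennreal_plus[symmetric]) auto
      also have "?g y + ?g (- y) = xi_kernel y * cosh ((s - 1/2) * y) + (exp ((1 - s) * y) - exp (- s * y))"
        using eq gm by linarith
      also have "ennreal \<dots> = ennreal (xi_kernel y * cosh ((s - 1/2) * y)) + ennreal (exp ((1 - s) * y) - exp (- s * y))"
        using True xi_kernel_nonneg[of y] by (intro ennreal_plus) (auto simp: algebra_simps cosh_real_nonneg)
      finally show ?thesis using True by simp
    qed simp
  qed
  also have "\<dots> = (\<integral>\<^sup>+y. ennreal (xi_kernel y * cosh ((s - 1/2) * y)) * indicator {0..} y \<partial>lborel)
       + (\<integral>\<^sup>+y. ennreal (exp ((1 - s) * y) - exp (- s * y)) * indicator {0..} y \<partial>lborel)"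
    by (rule nn_integral_add) auto
  finally show ?thesis unfolding nn_integral_exp_diff[OF s] by simp
qed

section \<open>Expansion of the cosh integral in powers of the squared distance from 1/2\<close>

lemma cosh_sums_even: "(\<lambda>k. x ^ (2 * k) / fact (2 * k)) sums cosh (x::real)"
proof -
  have "(\<lambda>n. if even n then x ^ n / fact n else 0) sums cosh x"
    using cosh_converges[of x] by (simp add: divide_inverse mult.commute cong: if_cong)
  then have "(\<lambda>k. (\<lambda>n. if even n then x ^ n / fact n else 0) (2 * k)) sums cosh x"
    by (subst sums_mono_reindex) (auto simp: strict_mono_def elim!: evenE)
  then show ?thesis by simp
qed

text \<open>Termwise integration of the cosh series makes this the coefficient of the
  \<open>k\<close>-th power of \<open>(s - 1/2)\<^sup>2\<close>. It is an extended real because its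
  finiteness follows only from the value of the whole sum.\<close>

definition xi_moment :: "nat \<Rightarrow> ennreal" where
  "xi_moment k = (\<integral>\<^sup>+y. ennreal (xi_kernel y * (y ^ (2 * k) / fact (2 * k))) * indicator {0..} y \<partial>lborel)"

definition xi_coeff :: "nat \<Rightarrow> real" where
  "xi_coeff k = enn2real (xi_moment k)"

lemma xi_coeff_nonneg: "xi_coeff k \<ge> 0"
  by (simp add: xi_coeff_def)

lemma xi_moment_suminf:
  assumes "s > 1"
  shows "(\<Sum>k. xi_moment k * ennreal (((s - 1/2)\<^sup>2) ^ k)) + ennreal (1 / (s - 1) - 1 / s)
    = ennreal (pi powr (- s / 2) * Gamma (s / 2) * real_zeta s)"
proof -
  let ?u = "s - 1/2"
  have "(\<integral>\<^sup>+y. ennreal (xi_kernel y * cosh (?u * y)) * indicator {0..} y \<partial>lborel) =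
     (\<integral>\<^sup>+y. (\<Sum>k. ennreal (xi_kernel y * (y ^ (2 * k) / fact (2 * k))) * indicator {0..} y * ennreal ((?u\<^sup>2) ^ k)) \<partial>lborel)"
  proof (intro nn_integral_cong)
    fix y :: real
    have "(\<lambda>k. xi_kernel y * ((?u * y) ^ (2 * k) / fact (2 * k))) sums (xi_kernel y * cosh (?u * y))"
      by (intro sums_mult cosh_sums_even)
    then have *: "ennreal (xi_kernel y * cosh (?u * y)) = (\<Sum>k. ennreal (xi_kernel y * ((?u * y) ^ (2 * k) / fact (2 * k))))"
      using xi_kernel_nonneg[of y] by (subst suminf_ennreal2) (auto simp: sums_iff intro!: mult_nonneg_nonneg)
    have "ennreal (xi_kernel y * ((?u * y) ^ (2 * k) / fact (2 * k))) = ennreal (xi_kernel y * (y ^ (2 * k) / fact (2 * k))) * ennreal ((?u\<^sup>2) ^ k)" for k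
    proof -
      have "xi_kernel y * ((?u * y) ^ (2 * k) / fact (2 * k)) = xi_kernel y * (y ^ (2 * k) / fact (2 * k)) * (?u\<^sup>2) ^ k"
        by (simp add: power_mult_distrib power_mult)
      moreover have "xi_kernel y * (y ^ (2 * k) / fact (2 * k)) \<ge> 0"
        using xi_kernel_nonneg[of y] by (intro mult_nonneg_nonneg) auto
      ultimately show ?thesis
        by (simp only: ennreal_mult zero_le_power zero_le_power2)
    qed
    with * show "ennreal (xi_kernel y * cosh (?u * y)) * indicator {0..} y =
      (\<Sum>k. ennreal (xi_kernel y * (y ^ (2 * k) / fact (2 * k))) * indicator {0..} y * ennreal ((?u\<^sup>2) ^ k))"
      by (auto simp: indicator_def)
  qed
  also have "\<dots> = (\<Sum>k. \<integral>\<^sup>+y. ennreal (xi_kernel y * (y ^ (2 * k) / fact (2 * k))) * indicator {0..} y * ennreal ((?u\<^sup>2) ^ k) \<partial>lborel)"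
    by (rule nn_integral_suminf) auto
  also have "\<dots> = (\<Sum>k. xi_moment k * ennreal ((?u\<^sup>2) ^ k))"
    unfolding xi_moment_def by (subst nn_integral_multc) auto
  finally show ?thesis using nn_integral_xi_kernel_cosh[OF assms] by simp
qed

text \<open>At \<open>s = 2\<close> the sum of all terms is finite, and the moment occurs in one of
  them with a positive factor.\<close>

lemma xi_moment_finite: "xi_moment k < \<top>"
proof -
  have "xi_moment k * ennreal (((2 - 1/2)\<^sup>2) ^ k) \<le> (\<Sum>k. xi_moment k * ennreal (((2 - 1/2)\<^sup>2) ^ k))"
    using sum_le_suminf[of "\<lambda>k. xi_moment k * ennreal (((2 - 1/2)\<^sup>2) ^ k)" "{k}"] by simp
  also have "\<dots> < \<top>"
  proof -
    have "(\<Sum>k. xi_moment k * ennreal (((2 - 1/2)\<^sup>2) ^ k)) + ennreal (1 / (2 - 1) - 1 / 2) < \<top>"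
      by (subst xi_moment_suminf) (simp, rule ennreal_less_top)
    then show ?thesis by (simp only: ennreal_add_less_top)
  qed
  finally show ?thesis by (auto simp: ennreal_mult_less_top)
qed

text \<open>Since \<open>s\<close> may be arbitrarily large, the power series in
  \<open>(s - 1/2)\<^sup>2\<close> converges everywhere; this is the analytic continuation.\<close>

lemma xi_coeff_sums:
  assumes s: "s > 1"
  shows "(\<lambda>k. xi_coeff k * ((s - 1/2)\<^sup>2) ^ k) sums (pi powr (- s / 2) * Gamma (s / 2) * real_zeta s - (1 / (s - 1) - 1 / s))"
proof -
  let ?X = "pi powr (- s / 2) * Gamma (s / 2) * real_zeta s"
  have "xi_moment k * ennreal (((s - 1/2)\<^sup>2) ^ k) = ennreal (xi_coeff k * ((s - 1/2)\<^sup>2) ^ k)" for k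
    using xi_moment_finite[of k] by (simp add: xi_coeff_def ennreal_mult)
  then have eq: "(\<Sum>k. ennreal (xi_coeff k * ((s - 1/2)\<^sup>2) ^ k)) + ennreal (1 / (s - 1) - 1 / s) = ennreal ?X"
    using xi_moment_suminf[OF s] by simp
  then have fin: "(\<Sum>k. ennreal (xi_coeff k * ((s - 1/2)\<^sup>2) ^ k)) \<noteq> \<top>" by auto
  have nn: "xi_coeff k * ((s - 1/2)\<^sup>2) ^ k \<ge> 0" for k by (simp add: xi_coeff_nonneg)
  have sm: "summable (\<lambda>k. xi_coeff k * ((s - 1/2)\<^sup>2) ^ k)"
    by (rule summable_suminf_not_top[OF nn fin])
  have "ennreal ((\<Sum>k. xi_coeff k * ((s - 1/2)\<^sup>2) ^ k) + (1 / (s - 1) - 1 / s)) = ennreal ?X"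
    using eq s suminf_ennreal2[OF nn sm] suminf_nonneg[OF sm nn]
    by (subst ennreal_plus) (auto simp: field_simps)
  moreover have "?X \<ge> 0"
    using s by (auto intro!: mult_nonneg_nonneg Gamma_real_nonneg sums_le[OF _ sums_zero real_zeta_sums])
  ultimately have "(\<Sum>k. xi_coeff k * ((s - 1/2)\<^sup>2) ^ k) + (1 / (s - 1) - 1 / s) = ?X"
  proof (subst (asm) ennreal_inj)
    have "1 / (s - 1) - 1 / s \<ge> 0" using s by (simp add: field_simps)
    then show "0 \<le> (\<Sum>k. xi_coeff k * ((s - 1/2)\<^sup>2) ^ k) + (1 / (s - 1) - 1 / s)"
      using suminf_nonneg[OF sm nn] by linarith
  qed
  then show ?thesis using sm by (simp add: sums_iff)
qed

section \<open>The completed zeta function\<close>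

text \<open>The variable is \<open>v = (s - 1/2)\<^sup>2\<close>, which equals
  \<open>1 / 4 - w\<close> for \<open>w = s - s\<^sup>2\<close>.\<close>

definition xi_series :: "complex \<Rightarrow> complex" where
  "xi_series v = (\<Sum>k. of_real (xi_coeff k) * v ^ k)"

text \<open>The completed zeta function in the variable \<open>w = s - s\<^sup>2\<close>, that is \<open>\<xi>(s) = xi_fun (s - s\<^sup>2)\<close>.\<close>
definition xi_fun :: "complex \<Rightarrow> complex" where
  "xi_fun w = 1 / 2 - w / 2 * xi_series (1 / 4 - w)"

definition completed_zeta :: "real \<Rightarrow> real" where
  "completed_zeta s = pi powr (- s / 2) * Gamma (s / 2) * real_zeta s"

text \<open>The coefficients are nonnegative, so the series at \<open>v\<close> is dominated by the
  one at the real point \<open>(s - 1/2)\<^sup>2\<close>. The subtracted term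
  \<open>1 / (s - 1) - 1 / s\<close> is positive and is dropped.\<close>

lemma xi_series_sums_bound:
  assumes s: "s > 1" and v: "norm v \<le> (s - 1/2)\<^sup>2"
  shows "(\<lambda>k. of_real (xi_coeff k) * v ^ k) sums xi_series v" "norm (xi_series v) \<le> completed_zeta s"
proof -
  let ?b = "\<lambda>k. xi_coeff k * ((s - 1/2)\<^sup>2) ^ k"
  have le: "norm (of_real (xi_coeff k) * v ^ k) \<le> ?b k" for k
    using v xi_coeff_nonneg[of k] by (auto simp: norm_mult norm_power intro!: mult_left_mono power_mono)
  have sm: "summable ?b" using xi_coeff_sums[OF s] by (simp add: sums_iff)
  have "summable (\<lambda>k. of_real (xi_coeff k) * v ^ k)"
    by (rule summable_comparison_test'[OF sm le])
  then show "(\<lambda>k. of_real (xi_coeff k) * v ^ k) sums xi_series v"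
    unfolding xi_series_def by (rule summable_sums)
  have "norm (xi_series v) \<le> (\<Sum>k. ?b k)"
    unfolding xi_series_def by (rule norm_suminf_le[OF le sm])
  also have "\<dots> = completed_zeta s - (1 / (s - 1) - 1 / s)"
    using xi_coeff_sums[OF s] by (simp add: sums_iff completed_zeta_def)
  also have "\<dots> \<le> completed_zeta s"
    using s by (simp add: field_simps)
  finally show "norm (xi_series v) \<le> completed_zeta s" .
qed

lemma xi_series_sums: "(\<lambda>k. of_real (xi_coeff k) * v ^ k) sums xi_series v"
proof (rule xi_series_sums_bound(1))
  \<comment> \<open>The witness is \<open>s = 2 + norm v\<close>, for which
    \<open>(s - 1/2)\<^sup>2\<close> exceeds \<open>norm v\<close>.\<close>
  have "norm v \<le> (1 + norm v)\<^sup>2" by (simp add: power2_eq_square algebra_simps)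
  also have "\<dots> \<le> ((2 + norm v) - 1/2)\<^sup>2" by (intro power_mono) auto
  finally show "norm v \<le> ((2 + norm v) - 1/2)\<^sup>2" .
qed (use norm_ge_zero[of v] in linarith)

lemma xi_series_holomorphic: "xi_series holomorphic_on A"
proof -
  have "xi_series holomorphic_on ball 0 (norm z + 1)" for z :: complex
    by (rule power_series_holomorphic[where a = "\<lambda>k. of_real (xi_coeff k)"]) (simp add: xi_series_sums)
  from holomorphic_on_imp_differentiable_at[OF this]
  have "xi_series field_differentiable at z" for z
    by (meson open_ball mem_ball_0 less_add_one)
  then show ?thesis
    by (auto simp: holomorphic_on_def intro: field_differentiable_at_within)
qed

lemma xi_fun_holomorphic: "xi_fun holomorphic_on A"
proof -
  have "(xi_series \<circ> (\<lambda>w. 1 / 4 - w)) holomorphic_on A"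
    by (rule holomorphic_on_compose_gen[of _ _ _ UNIV]) (auto intro!: holomorphic_intros xi_series_holomorphic)
  then show ?thesis unfolding xi_fun_def[abs_def] o_def by (intro holomorphic_intros) auto
qed

lemma xi_fun_0: "xi_fun 0 = 1 / 2"
  by (simp add: xi_fun_def)

section \<open>Special values and growth of the completed zeta function\<close>

lemma real_zeta_2: "real_zeta 2 = pi\<^sup>2 / 6"
proof -
  have "(\<lambda>n. 1 / real (Suc n) powr 2) sums (pi\<^sup>2 / 6)"
    using inverse_squares_sums by (simp add: add.commute)
  moreover have "(\<lambda>n. 1 / real (Suc n) powr 2) sums real_zeta 2"
    by (rule real_zeta_sums) simp
  ultimately show ?thesis by (rule sums_unique2[symmetric])
qed

text \<open>The point \<open>w = 1 / 4\<close> is \<open>s = 1 / 2\<close>. A zero there would force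
  \<open>xi_series 0 = 4\<close>, but the bound at \<open>s = 2\<close> is
  \<open>pi / 6\<close>.\<close>

lemma xi_fun_quarter_nonzero: "xi_fun (1 / 4) \<noteq> 0"
proof -
  have "(\<lambda>k. of_real (xi_coeff k) * (0::complex) ^ k) sums xi_series 0" by (rule xi_series_sums)
  then have "xi_series 0 = of_real (xi_coeff 0)"
    by (simp add: powser_sums_zero_iff)
  moreover have "norm (xi_series 0) \<le> completed_zeta 2" by (rule xi_series_sums_bound) auto
  moreover have "completed_zeta 2 = pi / 6"
    by (simp add: completed_zeta_def real_zeta_2 powr_minus_divide power2_eq_square)
  ultimately have "norm (xi_series 0) < 4" using pi_less_4 by linarith
  then have "xi_series 0 \<noteq> 4" by auto
  then show ?thesis by (auto simp: xi_fun_def)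
qed

text \<open>The elementary part contributes \<open>- 1 / 2\<close> after multiplication by
  \<open>(s - s\<^sup>2) / 2\<close>, which cancels the constant \<open>1 / 2\<close> in
  \<open>xi_fun\<close>. Writing \<open>Gamma (s / 2 + 1)\<close> absorbs the factor
  \<open>s / 2\<close>, so that nothing singular at 0 remains.\<close>

lemma xi_fun_real:
  assumes s: "s > 1"
  shows "xi_fun (of_real (s - s\<^sup>2)) = of_real ((s - 1) * pi powr (- s / 2) * Gamma (s / 2 + 1) * real_zeta s)"
proof -
  have v: "1 / 4 - complex_of_real (s - s\<^sup>2) = of_real ((s - 1/2)\<^sup>2)"
    by (simp add: power2_eq_square algebra_simps flip: of_real_mult of_real_diff of_real_add)
  have "(\<lambda>k. of_real (xi_coeff k) * complex_of_real ((s - 1/2)\<^sup>2) ^ k) sums of_real (completed_zeta s - (1 / (s - 1) - 1 / s))"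
    using sums_of_real[OF xi_coeff_sums[OF s], where 'a=complex] by (simp add: completed_zeta_def)
  with xi_series_sums have "xi_series (of_real ((s - 1/2)\<^sup>2)) = of_real (completed_zeta s - (1 / (s - 1) - 1 / s))"
    by (rule sums_unique2)
  then have "xi_fun (of_real (s - s\<^sup>2)) = of_real (1 / 2 - (s - s\<^sup>2) / 2 * (completed_zeta s - (1 / (s - 1) - 1 / s)))"
    unfolding xi_fun_def v by simp
  also have "1 / 2 - (s - s\<^sup>2) / 2 * (completed_zeta s - (1 / (s - 1) - 1 / s)) = (s - 1) * (s / 2) * completed_zeta s"
  proof -
    have "(s - s\<^sup>2) / 2 * (1 / (s - 1) - 1 / s) = - 1 / 2"
      using s by (simp add: field_simps power2_eq_square)
    moreover have "(s - s\<^sup>2) / 2 = - ((s - 1) * (s / 2))" by (simp add: power2_eq_square field_simps)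
    ultimately show ?thesis by (simp add: right_diff_distrib)
  qed
  also have "(s - 1) * (s / 2) * completed_zeta s = (s - 1) * pi powr (- s / 2) * Gamma (s / 2 + 1) * real_zeta s"
  proof -
    have "s / 2 \<notin> \<int>\<^sub>\<le>\<^sub>0" using s by (auto elim!: nonpos_Ints_cases)
    then have "Gamma (s / 2 + 1) = s / 2 * Gamma (s / 2)" by (intro Gamma_plus1) auto
    then show ?thesis by (simp add: completed_zeta_def)
  qed
  finally show ?thesis .
qed

text \<open>At even integers the Gamma factor is a factorial, at most
  \<open>m ^ m = exp (m * ln m)\<close>, and \<open>ln m \<le> 2 * sqrt m\<close>. The factor 2 is
  \<open>1/2 * 4\<close>, from the bounds for the power of \<open>pi\<close> and for
  \<open>real_zeta 2\<close>.\<close>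

lemma completed_zeta_even_le:
  assumes "m \<ge> 1"
  shows "completed_zeta (2 * real m) \<le> 2 * exp (2 * real m powr (3/2))"
proof -
  have z: "real_zeta (2 * real m) \<le> real_zeta 2"
    using assms
    by (intro sums_le[OF _ real_zeta_sums real_zeta_sums] divide_left_mono powr_mono) auto
  have z0: "0 \<le> real_zeta (2 * real m)"
    using assms by (intro sums_le[OF _ sums_zero real_zeta_sums]) auto
  have "pi\<^sup>2 / 6 \<le> 4" 
  proof -
    have "pi * pi \<le> 4 * 4" using pi_less_4 pi_gt_zero by (intro mult_mono) auto
    then show ?thesis by (simp add: power2_eq_square)
  qed
  moreover have "pi powr (- (2 * real m) / 2) \<le> 1 / 2"
  proof -
    have "pi powr (- (2 * real m) / 2) \<le> pi powr (-1)"
      using assms pi_gt3 by (intro powr_mono) auto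
    also have "\<dots> \<le> 1 / 2" using pi_gt3 by (simp add: powr_minus_divide field_simps)
    finally show ?thesis .
  qed
  ultimately have a: "pi powr (- (2 * real m) / 2) * real_zeta (2 * real m) \<le> 1 / 2 * 4"
    using z z0 real_zeta_2 by (intro mult_mono) auto
  have "Gamma (2 * real m / 2) = fact (m - 1)"
    using assms Gamma_fact[of "m - 1", where 'a=real] by (simp add: of_nat_diff)
  also have "\<dots> \<le> fact m" by (intro fact_mono) auto
  also have "(fact m :: real) \<le> real m ^ m" using fact_le_power[of m] by simp
  also have "\<dots> = exp (real m * ln (real m))"
    using assms by (simp add: exp_of_nat_mult)
  also have "\<dots> \<le> exp (2 * real m powr (3/2))"
  proof -
    have "ln (real m) = 2 * ln (sqrt (real m))" using assms by (simp add: ln_sqrt)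
    also have "\<dots> \<le> 2 * sqrt (real m)" using assms ln_le_minus_one[of "sqrt (real m)"] by simp
    finally have "real m * ln (real m) \<le> real m * (2 * sqrt (real m))"
      by (intro mult_left_mono) auto
    also have "\<dots> = 2 * real m powr (3/2)"
      using assms powr_add[of "real m" 1 "1/2"] by (simp add: powr_half_sqrt)
    finally show ?thesis by simp
  qed
  finally have g: "Gamma (2 * real m / 2) \<le> exp (2 * real m powr (3/2))" .
  have "completed_zeta (2 * real m) = pi powr (- (2 * real m) / 2) * real_zeta (2 * real m) * Gamma (2 * real m / 2)"
    by (simp add: completed_zeta_def)
  also have "\<dots> \<le> 2 * exp (2 * real m powr (3/2))"
    using a g z0 assms by (intro mult_mono Gamma_real_nonneg) auto
  finally show ?thesis .
qed

text \<open>With \<open>T = 1 + norm w\<close> the bound at a suitable even integer gives the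
  exponent \<open>12 * T powr (3/4)\<close>, from \<open>2 * 3 powr (3/2) \<le> 12\<close>. The
  remaining factor \<open>2 * T\<close> costs another \<open>3 * T powr (3/4)\<close>; together this
  makes 15.\<close>

lemma xi_fun_growth: "norm (xi_fun w) \<le> exp (15 * (1 + norm w) powr (3/4))"
proof -
  define T where "T = 1 + norm w"
  have T: "T \<ge> 1" by (simp add: T_def)
  \<comment> \<open>Large enough for \<open>1 / 4 - w\<close> to lie in the disc of radius
    \<open>(2 * m - 1/2)\<^sup>2\<close>, yet still of size \<open>O(sqrt T)\<close>.\<close>
  define m where "m = nat \<lceil>sqrt T\<rceil> + 1"
  have m: "m \<ge> 1" "real m \<ge> sqrt T" "real m \<le> sqrt T + 2" unfolding m_def using T by (auto, linarith+)
  have "sqrt T \<ge> 1" using T by simp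
  then have m3: "real m \<le> 3 * sqrt T" using m by linarith
  have Tp: "T powr (3/4) \<ge> 1" using T by (simp add: ge_one_powr_ge_zero)
  have "norm (1 / 4 - w) \<le> T"
    using norm_triangle_ineq4[of "1/4" w] by (simp add: T_def)
  also have "\<dots> = (sqrt T)\<^sup>2" using T by simp
  also have "\<dots> \<le> (2 * real m - 1/2)\<^sup>2"
  proof (rule power_mono)
    show "sqrt T \<le> 2 * real m - 1/2" using m(2) \<open>sqrt T \<ge> 1\<close> by linarith
  qed (use T in simp)
  finally have "norm (xi_series (1 / 4 - w)) \<le> completed_zeta (2 * real m)"
    using m by (intro xi_series_sums_bound(2)) auto
  also have "\<dots> \<le> 2 * exp (2 * real m powr (3/2))" by (rule completed_zeta_even_le[OF m(1)])
  also have "\<dots> \<le> 2 * exp (12 * T powr (3/4))"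
  proof -
    have "real m powr (3/2) \<le> (3 * sqrt T) powr (3/2)" using m3 by (intro powr_mono2) auto
    also have "\<dots> = 3 powr (3/2) * (T powr (1/2)) powr (3/2)"
      using T by (simp add: powr_mult powr_half_sqrt)
    also have "(T powr (1/2)) powr (3/2) = T powr (3/4)" by (simp add: powr_powr)
    also have "3 powr (3/2) * T powr (3/4) \<le> 6 * T powr (3/4)"
    proof -
      have "3 powr (3/2) = 3 * sqrt (3::real)" using powr_add[of "3::real" 1 "1/2"] by (simp add: powr_half_sqrt)
      moreover have "sqrt (3::real) \<le> 2" by (rule real_le_lsqrt) auto
      ultimately show ?thesis by (intro mult_right_mono) auto
    qed
    finally show ?thesis by simp
  qed
  finally have S: "norm (xi_series (1 / 4 - w)) \<le> 2 * exp (12 * T powr (3/4))" .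
  have "norm (xi_fun w) \<le> norm (1 / 2 :: complex) + norm (w / 2 * xi_series (1 / 4 - w))"
    unfolding xi_fun_def by (rule norm_triangle_ineq4)
  also have "\<dots> \<le> 1 / 2 + (T / 2) * (2 * exp (12 * T powr (3/4)))"
    unfolding norm_mult using S by (intro add_mono mult_mono) (auto simp: T_def norm_divide)
  also have "\<dots> \<le> (2 * T) * exp (12 * T powr (3/4))"
  proof -
    have "1 * 1 \<le> T * exp (12 * T powr (3/4))" using T by (intro mult_mono) auto
    then show ?thesis by simp
  qed
  also have "2 * T \<le> exp (3 * T powr (3/4))"
  proof -
    have "ln T = 4 / 3 * ln (T powr (3/4))" using T by (simp add: ln_powr)
    also have "\<dots> \<le> 4 / 3 * T powr (3/4)" using T Tp ln_le_minus_one[of "T powr (3/4)"] by simp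
    finally have "ln 2 + ln T \<le> 3 * T powr (3/4)" using Tp ln_le_minus_one[of "2::real"] by simp
    then have "exp (ln 2 + ln T) \<le> exp (3 * T powr (3/4))" by simp
    then show ?thesis using T by (simp add: exp_add)
  qed
  also have "exp (3 * T powr (3/4)) * exp (12 * T powr (3/4)) = exp (15 * T powr (3/4))"
    by (simp add: mult_exp_exp)
  finally show ?thesis by (simp add: T_def)
qed

section \<open>Identification with the Riemann zeta function\<close>

lemma norm_inverse_Suc_powr: "norm (1 / of_nat (Suc n) powr s :: complex) = 1 / real (Suc n) powr Re s"
  by (simp add: norm_divide norm_powr_real_powr del: of_nat_Suc)

lemma dirichlet_series_sums:
  assumes "Re s > 1"
  shows "(\<lambda>n. 1 / of_nat (Suc n) powr s) sums (\<Sum>n. 1 / of_nat (Suc n) powr s :: complex)"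
proof (rule summable_sums, rule summable_comparison_test')
  show "summable (\<lambda>n. 1 / real (Suc n) powr Re s)"
    using real_zeta_sums[OF assms] by (simp only: sums_iff)
qed (simp only: norm_inverse_Suc_powr)

lemma dirichlet_series_holomorphic:
  "(\<lambda>s. \<Sum>n. 1 / of_nat (Suc n) powr s :: complex) holomorphic_on {s. Re s > 1}"
proof (rule holomorphic_uniform_sequence)
  let ?f = "\<lambda>n s. 1 / of_nat (Suc n) powr s :: complex"
  show "open {s. Re s > 1}" by (rule open_halfspace_Re_gt)
  show "(\<lambda>s. \<Sum>n<N. ?f n s) holomorphic_on {s. Re s > 1}" for N
    by (intro holomorphic_intros) (auto simp del: of_nat_Suc)
  fix s :: complex assume s: "s \<in> {s. Re s > 1}"
  define d where "d = (Re s - 1) / 2"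
  have d: "d > 0" "Re s - d > 1" using s by (auto simp: d_def field_simps)
  have sub: "Re w \<ge> Re s - d" if "w \<in> cball s d" for w
    using that abs_Re_le_cmod[of "s - w"] by (auto simp: dist_norm)
  show "\<exists>d>0. cball s d \<subseteq> {s. Re s > 1} \<and> uniform_limit (cball s d) (\<lambda>N s. \<Sum>n<N. ?f n s) (\<lambda>s. \<Sum>n. ?f n s) sequentially"
  proof (intro exI conjI)
    show "cball s d \<subseteq> {s. Re s > 1}" using sub d by force
    show "uniform_limit (cball s d) (\<lambda>N s. \<Sum>n<N. ?f n s) (\<lambda>s. \<Sum>n. ?f n s) sequentially"
    proof (rule Weierstrass_m_test)
      show "summable (\<lambda>n. 1 / real (Suc n) powr (Re s - d))"
        using real_zeta_sums[OF d(2)] by (simp only: sums_iff)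
      fix n w assume "w \<in> cball s d"
      then show "norm (?f n w) \<le> 1 / real (Suc n) powr (Re s - d)"
        unfolding norm_inverse_Suc_powr using sub by (intro divide_left_mono powr_mono) auto
    qed
  qed (rule d)
qed

text \<open>The reciprocal Gamma function at \<open>s / 2 + 1\<close> combines the denominator
  factors \<open>s / 2\<close> and \<open>Gamma (s / 2)\<close> into an entire function, which
  leaves 1 as the only possible singularity.\<close>

definition zeta_cont :: "complex \<Rightarrow> complex" where
  "zeta_cont s = (if s = 1 then 0 else xi_fun (s - s\<^sup>2) * (of_real pi powr (s / 2) * rGamma (s / 2 + 1) / (s - 1)))"

lemma xi_fun_comp_holomorphic: "(\<lambda>s. xi_fun (s - s\<^sup>2)) holomorphic_on A"
proof -
  have "(xi_fun \<circ> (\<lambda>s. s - s\<^sup>2)) holomorphic_on A"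
    by (rule holomorphic_on_compose_gen[of _ _ _ UNIV]) (auto intro!: holomorphic_intros xi_fun_holomorphic)
  then show ?thesis by (simp add: o_def)
qed

lemma zeta_cont_holomorphic: "zeta_cont holomorphic_on - {1}"
proof (rule holomorphic_transform)
  show "(\<lambda>s. xi_fun (s - s\<^sup>2) * (of_real pi powr (s / 2) * rGamma (s / 2 + 1) / (s - 1))) holomorphic_on - {1}"
    by (intro holomorphic_intros xi_fun_comp_holomorphic) auto
qed (auto simp: zeta_cont_def)

lemma zeta_cont_real:
  assumes s: "s > 1"
  shows "zeta_cont (of_real s) = of_real (real_zeta s)"
proof -
  have "s / 2 + 1 > 0" using s by simp
  then have g: "Gamma (s / 2 + 1) * rGamma (s / 2 + 1) = 1"
    using Gamma_real_pos[of "s/2+1"] unfolding rGamma_inverse_Gamma by (metis less_irrefl right_inverse)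
  have "zeta_cont (of_real s) = of_real ((s - 1) * pi powr (- s / 2) * Gamma (s / 2 + 1) * real_zeta s
      * (pi powr (s / 2) * rGamma (s / 2 + 1) / (s - 1)))"
  proof -
    have "xi_fun (complex_of_real s - (complex_of_real s)\<^sup>2) = of_real ((s - 1) * pi powr (- s / 2) * Gamma (s / 2 + 1) * real_zeta s)"
      using xi_fun_real[OF s] by simp
    moreover have "complex_of_real pi powr (of_real s / 2) = of_real (pi powr (s / 2))"
      using powr_of_real[of pi "s/2"] by simp
    moreover have "rGamma (complex_of_real s / 2 + 1) = of_real (rGamma (s / 2 + 1))"
      using rGamma_complex_of_real[of "s/2+1"] by simp
    moreover have "complex_of_real s \<noteq> 1" using s by auto
    ultimately show ?thesis
      by (simp only: zeta_cont_def of_real_mult of_real_divide of_real_diff of_real_1 if_False)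
  qed
  also have "(s - 1) * pi powr (- s / 2) * Gamma (s / 2 + 1) * real_zeta s
      * (pi powr (s / 2) * rGamma (s / 2 + 1) / (s - 1)) = real_zeta s * (pi powr (- s / 2) * pi powr (s / 2)) * (Gamma (s / 2 + 1) * rGamma (s / 2 + 1))"
    using s by (simp add: field_simps)
  also have "\<dots> = real_zeta s" unfolding g by (simp flip: powr_add)
  finally show ?thesis .
qed

lemma holomorphic_eq_on_islimpt:
  assumes "f holomorphic_on S" "g holomorphic_on S" "open S" "connected S" "U \<subseteq> S" "\<xi> \<in> S" "\<xi> islimpt U"
    and "\<And>z. z \<in> U \<Longrightarrow> f z = g z" and "w \<in> S"
  shows "f w = g w"
proof -
  have "(\<lambda>z. f z - g z) w = 0"
    by (rule analytic_continuation[where S = S and U = U and \<xi> = \<xi>]) (use assms in \<open>auto intro: holomorphic_intros\<close>)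
  then show ?thesis by simp
qed

text \<open>Both sides are holomorphic on the half-plane and agree for real \<open>s > 1\<close>, so
  the identity theorem applies; 2 serves as the limit point.\<close>

lemma zeta_cont_dirichlet:
  assumes "Re s > 1"
  shows "zeta_cont s = (\<Sum>n. 1 / of_nat (Suc n) powr s)"
proof (rule holomorphic_eq_on_islimpt[where f = zeta_cont and g = "\<lambda>s. \<Sum>n. 1 / of_nat (Suc n) powr s" and S = "{s. Re s > 1}" and U = "of_real ` {1<..}" and \<xi> = 2])
  show "open {s. Re s > 1}" by (rule open_halfspace_Re_gt)
  show "connected {s. Re s > 1}" by (intro convex_connected convex_halfspace_Re_gt)
  show "zeta_cont holomorphic_on {s. Re s > 1}"
    by (rule holomorphic_on_subset[OF zeta_cont_holomorphic]) auto
  show "(\<lambda>s. \<Sum>n. 1 / of_nat (Suc n) powr s :: complex) holomorphic_on {s. Re s > 1}"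
    by (rule dirichlet_series_holomorphic)
  show "2 islimpt complex_of_real ` {1<..}"
  proof -
    have "\<exists>x'\<in>complex_of_real ` {1<..}. x' \<noteq> 2 \<and> dist x' 2 < e" if "e > 0" for e
    proof (intro bexI conjI)
      have eq: "complex_of_real (2 + e / 2) = 2 + of_real (e / 2)" by simp
      show "complex_of_real (2 + e / 2) \<in> complex_of_real ` {1<..}" using that by (intro imageI) auto
      show "complex_of_real (2 + e / 2) \<noteq> 2" unfolding eq using that by (simp add: of_real_eq_0_iff del: of_real_divide)
      show "dist (complex_of_real (2 + e / 2)) 2 < e"
        unfolding eq dist_norm add_diff_cancel_left' norm_of_real using that by simp
    qed
    then show ?thesis by (simp add: islimpt_approachable)
  qed
  fix z assume "z \<in> complex_of_real ` {1<..}"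
  then obtain x where x: "z = of_real x" "x > 1" by auto
  have "(\<lambda>n. complex_of_real (1 / real (Suc n) powr x)) sums of_real (real_zeta x)"
    by (intro sums_of_real real_zeta_sums x)
  moreover have "complex_of_real (1 / real (Suc n) powr x) = 1 / of_nat (Suc n) powr z" for n
    using powr_of_real[of "real (Suc n)" x] by (simp add: x(1) del: of_nat_Suc)
  ultimately show "zeta_cont z = (\<Sum>n. 1 / of_nat (Suc n) powr z)"
    unfolding x(1) zeta_cont_real[OF x(2)] by (simp only: sums_iff)
qed (use assms in auto)

text \<open>Uniqueness for the definite description comes from the identity theorem, because the
  punctured plane is connected.\<close>

lemma riemann_zeta_eq_zeta_cont: "riemann_zeta = zeta_cont"
  unfolding riemann_zeta_def
proof (rule the_equality)
  show "zeta_cont holomorphic_on - {1} \<and> zeta_cont 1 = 0 \<and> (\<forall>s. 1 < Re s \<longrightarrow> zeta_cont s = (\<Sum>n. 1 / of_nat (Suc n) powr s))"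
    using zeta_cont_holomorphic zeta_cont_dirichlet by (auto simp: zeta_cont_def)
  fix f :: "complex \<Rightarrow> complex"
  assume f: "f holomorphic_on - {1} \<and> f 1 = 0 \<and> (\<forall>s. 1 < Re s \<longrightarrow> f s = (\<Sum>n. 1 / of_nat (Suc n) powr s))"
  show "f = zeta_cont"
  proof
    fix s
    show "f s = zeta_cont s"
    proof (cases "s = 1")
      case False
      show ?thesis
      proof (rule analytic_continuation_open[where f = f and g = zeta_cont and s' = "- {1}" and s = "{s. Re s > 1}"])
        show "connected (- {1::complex})" by (rule connected_punctured_universe) simp
        show "{s. 1 < Re s} \<noteq> {}" by (auto intro: exI[of _ 2])
        show "f z = zeta_cont z" if "z \<in> {s. 1 < Re s}" for z using f that zeta_cont_dirichlet by auto
      qed (use f False zeta_cont_holomorphic open_halfspace_Re_gt in auto)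
    qed (use f in \<open>simp add: zeta_cont_def\<close>)
  qed
qed

lemma riemann_zeta_xi:
  "s \<noteq> 1 \<Longrightarrow> riemann_zeta s = xi_fun (s - s\<^sup>2) * (of_real pi powr (s / 2) * rGamma (s / 2 + 1) / (s - 1))"
  by (simp add: riemann_zeta_eq_zeta_cont zeta_cont_def)

text \<open>The bound on the real part keeps \<open>s\<close> to the right of
  \<open>-2, -4, ...\<close>, where the reciprocal Gamma factor produces the trivial zeros.\<close>

lemma zeta_factor_nonzero:
  assumes "s \<noteq> 1" "Re s > -2"
  shows "of_real pi powr (s / 2) * rGamma (s / 2 + 1) / (s - 1) \<noteq> 0"
proof -
  have "s / 2 + 1 \<notin> \<int>\<^sub>\<le>\<^sub>0"
  proof
    assume "s / 2 + 1 \<in> \<int>\<^sub>\<le>\<^sub>0"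
    then obtain n where n: "s / 2 + 1 = of_int n" "n \<le> 0" by (auto elim!: nonpos_Ints_cases)
    have "Re (s / 2 + 1) \<le> 0" unfolding n(1) using n(2) by simp
    then show False using assms by simp
  qed
  then show ?thesis using assms by (simp add: rGamma_eq_zero_iff)
qed

lemma riemann_zeta_eq_0_iff_xi:
  assumes "s \<noteq> 1" "Re s > -2"
  shows "riemann_zeta s = 0 \<longleftrightarrow> xi_fun (s - s\<^sup>2) = 0"
  using zeta_factor_nonzero[OF assms] by (simp add: riemann_zeta_xi[OF assms(1)])

section \<open>Finite Euler products and nonvanishing to the right of 1\<close>

definition sifted :: "nat set \<Rightarrow> nat \<Rightarrow> bool" where
  "sifted P n \<longleftrightarrow> n > 0 \<and> (\<forall>p\<in>P. \<not> p dvd n)"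

text \<open>A sieve: multiplication by \<open>1 - 1 / q powr s\<close> removes exactly the terms
  whose index is divisible by \<open>q\<close>.\<close>

lemma euler_product_partial:
  fixes s :: complex
  assumes s: "Re s > 1" and P: "finite P" "\<And>p. p \<in> P \<Longrightarrow> prime p"
  shows "(\<lambda>n. if sifted P n then 1 / of_nat n powr s else 0) sums
           ((\<Sum>n. 1 / of_nat (Suc n) powr s) * (\<Prod>p\<in>P. 1 - 1 / of_nat p powr s))"
  using P
proof (induction P rule: finite_induct)
  case empty
  have "(\<lambda>n. (\<lambda>n. if sifted {} n then 1 / of_nat n powr s else 0) (Suc n)) sums (\<Sum>n. 1 / of_nat (Suc n) powr s)"
    using dirichlet_series_sums[OF s] by (simp add: sifted_def)
  from sums_Suc[OF this] show ?case by (simp add: sifted_def)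
next
  case (insert q P)
  let ?f = "\<lambda>n. if sifted P n then 1 / of_nat n powr s else 0"
  let ?S = "(\<Sum>n. 1 / of_nat (Suc n) powr s) * (\<Prod>p\<in>P. 1 - 1 / of_nat p powr s)"
  have q: "prime q" using insert by simp
  then have q0: "q > 0" by (simp add: prime_gt_0_nat)
  have IH: "?f sums ?S" using insert by simp
  let ?h = "\<lambda>n. if q dvd n then ?f n else 0"
  \<comment> \<open>No prime of \<open>P\<close> equals \<open>q\<close>, so multiplication by
    \<open>q\<close> does not change divisibility by the elements of \<open>P\<close>.\<close>
  have "?h (q * m) = 1 / of_nat q powr s * ?f m" for m
  proof -
    have "sifted P (q * m) \<longleftrightarrow> sifted P m"
    proof -
      have "p dvd q * m \<longleftrightarrow> p dvd m" if "p \<in> P" for p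
        using insert.prems[of p] insert.hyps(2) that q by (metis insertCI prime_dvd_mult_iff primes_dvd_imp_eq)
      then show ?thesis using q0 by (auto simp: sifted_def)
    qed
    moreover have "(of_nat (q * m) :: complex) powr s = of_nat q powr s * of_nat m powr s"
      unfolding of_nat_mult using powr_times_real[of "of_nat q" "of_nat m" s] by simp
    ultimately show ?thesis by simp
  qed
  then have "(\<lambda>m. ?h (q * m)) sums (1 / of_nat q powr s * ?S)"
    using sums_mult[OF IH, of "1 / of_nat q powr s"] by presburger
  then have "?h sums (1 / of_nat q powr s * ?S)"
    by (subst (asm) sums_mono_reindex) (use q0 in \<open>auto simp: strict_mono_def elim!: dvdE\<close>)
  from sums_diff[OF IH this] have "(\<lambda>n. ?f n - ?h n) sums (?S - 1 / of_nat q powr s * ?S)" .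
  moreover have "(\<lambda>n. ?f n - ?h n) = (\<lambda>n. if sifted (insert q P) n then 1 / of_nat n powr s else 0)"
    by (auto simp: sifted_def)
  moreover have "?S - 1 / of_nat q powr s * ?S = (\<Sum>n. 1 / of_nat (Suc n) powr s) * (\<Prod>p\<in>insert q P. 1 - 1 / of_nat p powr s)"
    using insert.hyps by (simp add: algebra_simps)
  ultimately show ?case by (simp only:)
qed

text \<open>If zeta vanished, every sifted series would sum to 0. After sifting by all primes up to
  \<open>M\<close> the term 1 survives alone among the indices up to \<open>M\<close>, while the
  tail has modulus less than 1.\<close>

lemma riemann_zeta_nonzero_Re_gt_1:
  assumes s: "Re s > 1"
  shows "riemann_zeta s \<noteq> 0"
proof
  assume "riemann_zeta s = 0"
  then have z0: "(\<Sum>n. 1 / of_nat (Suc n) powr s) = 0"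
    using zeta_cont_dirichlet[OF s] by (simp add: riemann_zeta_eq_zeta_cont)
  let ?t = "\<lambda>n. 1 / real (Suc n) powr Re s"
  have sm: "summable ?t" using real_zeta_sums[OF s] by (simp only: sums_iff)
  obtain N where N: "(\<Sum>n. ?t (n + N)) < 1"
  proof -
    obtain N where "norm (\<Sum>i. ?t (i + N)) < 1"
      using suminf_exist_split[OF zero_less_one sm] by blast
    then have "(\<Sum>i. ?t (i + N)) < 1" unfolding real_norm_def by (rule abs_less_iff[THEN iffD1, THEN conjunct1])
    then show ?thesis by (rule that)
  qed
  \<comment> \<open>At least 1 even for \<open>N = 0\<close>, so that the index 1 belongs to the
    initial segment split off below.\<close>
  define M where "M = Suc N"
  define P where "P = {p. prime p \<and> p \<le> M}"
  let ?f = "\<lambda>n. if sifted P n then 1 / of_nat n powr s else (0::complex)"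
  have "finite P" by (rule finite_subset[of _ "{..M}"]) (auto simp: P_def)
  then have "?f sums ((\<Sum>n. 1 / of_nat (Suc n) powr s) * (\<Prod>p\<in>P. 1 - 1 / of_nat p powr s))"
    by (rule euler_product_partial[OF s]) (simp add: P_def)
  then have fP: "?f sums 0" by (simp only: z0 mult_zero_left)
  have ns: "\<not> sifted P n" if n: "n \<noteq> 1" "n \<le> M" for n
  proof (cases "n = 0")
    case False
    then obtain p where "prime p" "p dvd n" using prime_factor_nat[OF n(1)] by blast
    moreover have "p \<le> n" using False \<open>p dvd n\<close> by (simp add: dvd_imp_le)
    ultimately show ?thesis using n by (auto simp: sifted_def P_def)
  qed (simp add: sifted_def)
  have s1: "sifted P 1" by (auto simp: sifted_def P_def)
  have "(\<Sum>n<Suc M. ?f n) = (\<Sum>n\<in>{1}. ?f n)"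
    by (rule sum.mono_neutral_right) (use ns in \<open>auto simp: M_def\<close>)
  then have "(\<Sum>n<Suc M. ?f n) = 1" using s1 by simp
  then have "(\<lambda>n. ?f (n + Suc M)) sums (0 - 1)"
    using sums_split_initial_segment[OF fP, of "Suc M"] by simp
  then have "norm (0 - 1 :: complex) \<le> (\<Sum>n. ?t (n + N))"
  proof (rule norm_sums_le)
    show "(\<lambda>n. ?t (n + N)) sums (\<Sum>n. ?t (n + N))" 
      by (rule summable_sums) (rule summable_ignore_initial_segment[OF sm])
    fix n
    have "norm (?f (n + Suc M)) \<le> 1 / real (n + Suc M) powr Re s"
      using norm_inverse_Suc_powr[of "n + M" s] by (simp del: of_nat_Suc of_nat_add)
    also have "\<dots> \<le> ?t (n + N)" using s by (intro divide_left_mono powr_mono2) (auto simp: M_def)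
    finally show "norm (?f (n + Suc M)) \<le> ?t (n + N)" .
  qed
  then show False using N by simp
qed

section \<open>Genus-zero product formula\<close>

text \<open>The map \<open>u \<mapsto> u / (2 * A - u)\<close> sends the half-plane
  \<open>Re u < A\<close> into the unit disc and fixes 0, so the Schwarz lemma applies to its
  composite with the rescaled \<open>f\<close>.\<close>

lemma borel_caratheodory:
  fixes f :: "complex \<Rightarrow> complex"
  assumes f: "f holomorphic_on ball 0 R" "f 0 = 0" and A: "\<And>z. norm z < R \<Longrightarrow> Re (f z) < A" and z: "norm z < R"
  shows "norm (f z) \<le> 2 * A * norm z / (R - norm z)"
proof -
  have R: "R > 0" using z norm_ge_zero[of z] by linarith
  have A0: "A > 0" using A[of 0] f R by simp
  define \<phi> where "\<phi> = (\<lambda>u. f (of_real R * u) / (of_real (2 * A) - f (of_real R * u)))"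
  have dom: "norm (of_real R * u) < R" if "norm u < 1" for u :: complex
    using that R by (simp add: norm_mult)
  have lt: "norm (f w) < norm (of_real (2 * A) - f w)" if "norm w < R" for w
  proof -
    have "A * Re (f w) < A * A" using A[OF that] A0 by simp
    then have "(norm (f w))\<^sup>2 < (norm (of_real (2 * A) - f w))\<^sup>2"
      unfolding cmod_power2 by (simp add: power2_eq_square algebra_simps)
    then show ?thesis by (rule power2_less_imp_less) auto
  qed
  have nz: "of_real (2 * A) - f w \<noteq> 0" if "norm w < R" for w
    using lt[OF that] by auto
  have hol: "(\<lambda>u. f (of_real R * u)) holomorphic_on ball 0 1"
  proof -
    have "(f \<circ> (\<lambda>u. of_real R * u)) holomorphic_on ball 0 1"
      by (rule holomorphic_on_compose_gen[OF _ f(1)]) (use dom in \<open>auto intro!: holomorphic_intros\<close>)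
    then show ?thesis by (simp add: o_def)
  qed
  have "norm (\<phi> (z / of_real R)) \<le> norm (z / of_real R)"
  proof (rule Schwarz_Lemma(1))
    show "\<phi> holomorphic_on ball 0 1"
      unfolding \<phi>_def by (intro holomorphic_intros hol) (use nz dom in auto)
    show "\<phi> 0 = 0" by (simp add: \<phi>_def f)
    show "norm (\<phi> u) < 1" if "norm u < 1" for u
      using lt[OF dom[OF that]] nz[OF dom[OF that]] by (simp add: \<phi>_def norm_divide)
    show "norm (z / of_real R) < 1" using z R by (simp add: norm_divide)
  qed
  then have "norm (f z) / norm (of_real (2 * A) - f z) \<le> norm z / R"
    using R by (simp add: \<phi>_def norm_divide)
  then have "norm (f z) * R \<le> norm z * norm (of_real (2 * A) - f z)"
    using R nz[OF z] by (simp add: field_simps)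
  also have "\<dots> \<le> norm z * (2 * A + norm (f z))"
    using norm_triangle_ineq4[of "of_real (2 * A)" "f z"] A0 by (intro mult_left_mono) (auto simp: norm_mult)
  finally have "norm (f z) * (R - norm z) \<le> 2 * A * norm z" by (simp add: algebra_simps)
  then show ?thesis using z by (simp add: field_simps)
qed

text \<open>The sequence lists some positive zeros of \<open>H\<close>, each with its full
  multiplicity, but \<open>H\<close> may have others. That it has none is assumed separately where
  the quotients must be zero-free.\<close>

locale entire_with_zeros =
  fixes H :: "complex \<Rightarrow> complex" and c :: "nat \<Rightarrow> real" and C :: real
  assumes hol: "H holomorphic_on UNIV"
    and H0: "H 0 \<noteq> 0"
    and C: "C \<ge> 0"
    and growth: "\<And>w. norm (H w) \<le> exp (C * (1 + norm w) powr (3/4))"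
    and c_pos: "\<And>n. c n > 0"
    and c_mono: "mono c"
    and zero: "\<And>n. H (of_real (c n)) = 0"
    and mult: "\<And>n. int (card {k. c k = c n}) = zorder H (of_real (c n))"
begin

section \<open>Division of \<open>H\<close> by partial products\<close>

definition P :: "nat \<Rightarrow> complex \<Rightarrow> complex" where
  "P N w = (\<Prod>k<N. 1 - w / of_real (c k))"

lemma P_0 [simp]: "P N 0 = 1" by (simp add: P_def)

lemma H_eventually_nonzero: "\<forall>\<^sub>F w in at z. H w \<noteq> 0"
  using non_zero_neighbour_alt[OF hol open_UNIV connected_UNIV UNIV_I UNIV_I H0, of z] by simp

lemma zorder_linear_factor:
  fixes a :: real
  assumes "a > 0"
  shows "zorder (\<lambda>w. 1 - w / of_real a) w0 = (if of_real a = w0 then 1 else 0)"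
proof (cases "of_real a = w0")
  case True
  have "zorder (\<lambda>w. 1 - w / of_real a) w0 = 1"
    by (rule zorder_eqI[of UNIV _ "\<lambda>_. - 1 / of_real a"]) (use assms True in \<open>auto simp: field_simps\<close>)
  then show ?thesis using True by simp
next
  case False
  have "(\<lambda>w. 1 - w / of_real a) analytic_on {w0}"
    using assms by (intro analytic_intros) auto
  moreover have "1 - w0 / of_real a \<noteq> 0" using assms False by (auto simp: field_simps)
  ultimately show ?thesis using False by (simp add: zorder_eq_0I)
qed

text \<open>Orders add under multiplication, and each linear factor has order 1 at its own root and
  0 elsewhere.\<close>

lemma zorder_quotient:
  assumes E: "E holomorphic_on UNIV" and eq: "\<And>w. H w = E w * P N w"
  shows "zorder H w0 = zorder E w0 + int (card {k. k < N \<and> of_real (c k) = w0})"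
proof -
  have Ean: "E analytic_on {w0}" using E by (simp add: analytic_on_holomorphic) blast
  have "\<forall>\<^sub>F w in at w0. E w * P N w \<noteq> 0" using H_eventually_nonzero[of w0] by (simp add: eq)
  then have "zorder (\<lambda>w. E w * P N w) w0 = zorder E w0 + int (card {k. k < N \<and> of_real (c k) = w0})"
  proof (induction N)
    case 0
    then show ?case by (simp add: P_def)
  next
    case (Suc N)
    have PS: "P (Suc N) w = P N w * (1 - w / of_real (c N))" for w by (simp add: P_def)
    have "\<forall>\<^sub>F w in at w0. E w * P N w \<noteq> 0" using Suc.prems by eventually_elim (auto simp: PS)
    then have IH: "zorder (\<lambda>w. E w * P N w) w0 = zorder E w0 + int (card {k. k < N \<and> of_real (c k) = w0})"
      by (rule Suc.IH)
    have "zorder (\<lambda>w. (E w * P N w) * (1 - w / of_real (c N))) w0 =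
        zorder (\<lambda>w. E w * P N w) w0 + zorder (\<lambda>w. 1 - w / of_real (c N)) w0"
    proof (rule zorder_times_analytic)
      show "(\<lambda>w. E w * P N w) analytic_on {w0}"
        unfolding P_def using c_pos by (intro analytic_intros Ean) (metis less_irrefl of_real_eq_0_iff)
      show "(\<lambda>w. 1 - w / of_real (c N)) analytic_on {w0}"
        using c_pos[of N] by (intro analytic_intros) auto
      show "\<forall>\<^sub>F w in at w0. E w * P N w * (1 - w / of_real (c N)) \<noteq> 0"
        using Suc.prems by (simp add: PS mult.assoc)
    qed
    moreover have "card {k. k < Suc N \<and> of_real (c k) = w0} =
        card {k. k < N \<and> of_real (c k) = w0} + (if of_real (c N) = w0 then 1 else 0)"
    proof -
      have "{k. k < Suc N \<and> of_real (c k) = w0} =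
         (if of_real (c N) = w0 then insert N {k. k < N \<and> of_real (c k) = w0} else {k. k < N \<and> of_real (c k) = w0})"
        by (auto simp: less_Suc_eq)
      then show ?thesis by simp
    qed
    ultimately show ?case
      using IH zorder_linear_factor[OF c_pos, of N w0] by (simp add: PS mult.assoc)
  qed
  moreover have "H = (\<lambda>w. E w * P N w)" using eq by auto
  ultimately show ?thesis by simp
qed

lemma quotient_eventually_nonzero:
  assumes eq: "\<And>w. H w = E w * P N w"
  shows "\<forall>\<^sub>F w in at w0. E w \<noteq> 0"
  using H_eventually_nonzero[of w0] by eventually_elim (auto simp: eq)

text \<open>The order of a zero is positive, whereas \<open>card\<close> of an infinite set would be
  0.\<close>

lemma finite_occurrences: "finite {k. c k = c n}"
proof -
  have "zorder H (of_real (c n)) > 0"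
  proof (subst zorder_pos_iff[OF hol open_UNIV UNIV_I])
    show "\<exists>\<^sub>F w in at (of_real (c n)). H w \<noteq> 0"
      using H_eventually_nonzero by (intro eventually_frequently) auto
  qed (rule zero)
  then have "card {k. c k = c n} > 0" using mult[of n] by linarith
  then show ?thesis by (simp add: card_gt_0_iff)
qed

text \<open>The indices below \<open>N\<close> with value \<open>c N\<close> are fewer than its
  multiplicity, since \<open>N\<close> itself is one more. Hence the \<open>N\<close>-th quotient
  still vanishes at \<open>c N\<close> and can be divided once more.\<close>

lemma quotient_exists: "\<exists>E. E holomorphic_on UNIV \<and> (\<forall>w. H w = E w * P N w)"
proof (induction N)
  case 0
  show ?case using hol by (intro exI[of _ H]) (simp add: P_def)
next
  case (Suc N)
  then obtain E where E: "E holomorphic_on UNIV" "\<And>w. H w = E w * P N w" by auto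
  let ?a = "complex_of_real (c N)"
  have a0: "?a \<noteq> 0" using c_pos[of N] by simp
  have "card (insert N {k. k < N \<and> c k = c N}) \<le> card {k. c k = c N}"
    by (rule card_mono[OF finite_occurrences]) auto
  then have "int (card {k. k < N \<and> c k = c N}) < zorder H ?a"
    unfolding mult[symmetric] by simp
  then have "zorder E ?a > 0"
    using zorder_quotient[OF E, of ?a] by simp
  then have Ea: "E ?a = 0"
    using zorder_pos_iff[OF E(1) open_UNIV UNIV_I, of ?a] quotient_eventually_nonzero[OF E(2), of ?a]
    by (simp add: eventually_frequently)
  define Q where "Q = (\<lambda>z. if z = ?a then deriv E ?a else (E z - E ?a) / (z - ?a))"
  have Q: "Q holomorphic_on UNIV"
    unfolding Q_def by (rule pole_lemma_open[OF E(1) open_UNIV])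
  show ?case
  proof (intro exI conjI allI)
    \<comment> \<open>The factor \<open>- ?a\<close> converts \<open>w - ?a\<close> into the
      normalised factor \<open>1 - w / ?a\<close>.\<close>
    show "(\<lambda>w. - ?a * Q w) holomorphic_on UNIV" by (intro holomorphic_intros Q)
    fix w
    have "E w = - ?a * Q w * (1 - w / ?a)"
      using a0 by (auto simp: Q_def Ea field_simps)
    then show "H w = - ?a * Q w * P (Suc N) w"
      by (simp add: E(2) P_def mult.assoc mult.commute[of "1 - w / ?a"])
  qed
qed

text \<open>An entire quotient is chosen because the pointwise quotient \<open>H w / P N w\<close>
  would be 0 at the roots of \<open>P N\<close> by the convention for division by zero.\<close>

definition E :: "nat \<Rightarrow> complex \<Rightarrow> complex" where
  "E N = (SOME E. E holomorphic_on UNIV \<and> (\<forall>w. H w = E w * P N w))"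

lemma E_holomorphic: "E N holomorphic_on A"
  using someI_ex[OF quotient_exists[of N], THEN conjunct1] unfolding E_def
  by (rule holomorphic_on_subset) simp

lemma E_eq: "H w = E N w * P N w"
  using someI_ex[OF quotient_exists[of N], THEN conjunct2] unfolding E_def by (rule spec)

lemma E_0: "E N 0 = H 0"
  using E_eq[of 0 N] by simp

text \<open>On the circle each \<open>z / c k\<close> with \<open>k < N\<close> has modulus at least
  4, so each factor has modulus at least 3. The radius factor 4 is convenient because
  \<open>ln 3 \<ge> 1\<close> in the zero count below.\<close>

lemma norm_E_le:
  assumes w: "norm w \<le> 4 * c N"
  shows "norm (E N w) \<le> exp (C * (1 + 4 * c N) powr (3/4)) / 3 ^ N"
proof (rule maximum_modulus_frontier[where f = "E N" and \<xi> = w and S = "cball 0 (4 * c N)"])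
  fix z :: complex assume "z \<in> frontier (cball 0 (4 * c N))"
  then have z: "norm z = 4 * c N" using c_pos[of N] by (simp add: frontier_cball)
  have "3 \<le> norm (1 - z / of_real (c k))" if "k < N" for k
  proof -
    have "c k \<le> c N" using c_mono that by (simp add: monoD)
    then have "4 \<le> norm (z / of_real (c k))"
      using c_pos[of k] by (simp add: norm_divide z field_simps)
    then show ?thesis using norm_triangle_ineq3[of 1 "z / of_real (c k)"] by simp
  qed
  then have "(\<Prod>k<N. 3) \<le> (\<Prod>k<N. norm (1 - z / of_real (c k)))"
    by (intro prod_mono) auto
  then have P3: "3 ^ N \<le> norm (P N z)" by (simp add: P_def prod_norm)
  have "norm (E N z) * 3 ^ N \<le> norm (E N z) * norm (P N z)"
    using P3 by (intro mult_left_mono) auto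
  also have "\<dots> = norm (H z)" by (simp add: E_eq[of z N] norm_mult)
  also have "\<dots> \<le> exp (C * (1 + 4 * c N) powr (3/4))" using growth[of z] by (simp add: z)
  finally show "norm (E N z) \<le> exp (C * (1 + 4 * c N) powr (3/4)) / 3 ^ N"
    by (simp add: field_simps)
qed (use w E_holomorphic in \<open>auto intro: holomorphic_on_imp_continuous_on\<close>)

text \<open>A zero count in the manner of Jensen: since \<open>E N 0 = H 0\<close>, the bound at the
  origin reads \<open>norm (H 0) * 3 ^ N \<le> exp (C * (1 + 4 * c N) powr (3/4))\<close>, and
  logarithms are taken.\<close>

lemma index_le_c_powr: "\<exists>A>0. \<forall>N. real N \<le> A * c N powr (3/4)"
proof -
  define L where "L = \<bar>ln (norm (H 0))\<bar>"
  define d where "d = c 0"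
  have d: "d > 0" using c_pos by (simp add: d_def)
  \<comment> \<open>From \<open>1 \<le> c N / d\<close> one gets
    \<open>1 + 4 * c N \<le> B * c N\<close>; the constant \<open>L\<close> is absorbed into a
    multiple of \<open>c N powr (3/4)\<close> in the same way.\<close>
  define B where "B = 1 / d + 4"
  have B: "B > 0" using d by (simp add: B_def add_pos_pos)
  define A where "A = C * B powr (3/4) + L / d powr (3/4) + 1"
  have A: "A > 0" using C d by (auto simp: A_def L_def intro!: add_nonneg_pos add_nonneg_nonneg)
  have "real N \<le> A * c N powr (3/4)" for N
  proof -
    have dc: "d \<le> c N" using c_mono by (simp add: d_def monoD)
    have "norm (H 0) \<le> exp (C * (1 + 4 * c N) powr (3/4)) / 3 ^ N"
      using norm_E_le[of 0 N] c_pos[of N] by (simp add: E_0)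
    then have "norm (H 0) * 3 ^ N \<le> exp (C * (1 + 4 * c N) powr (3/4))"
      by (simp add: field_simps)
    then have "ln (norm (H 0) * 3 ^ N) \<le> C * (1 + 4 * c N) powr (3/4)"
      using H0 by (subst ln_le_cancel_iff[symmetric, THEN iffD1, of _ "exp (C * (1 + 4 * c N) powr (3/4))", simplified]) auto
    then have "ln (norm (H 0)) + real N * ln 3 \<le> C * (1 + 4 * c N) powr (3/4)"
      using H0 by (simp add: ln_mult ln_realpow)
    moreover have "real N * 1 \<le> real N * ln 3"
      by (intro mult_left_mono) (use exp_le ln_ge_iff[of 3 1] in auto)
    ultimately have "real N \<le> C * (1 + 4 * c N) powr (3/4) + L" by (simp add: L_def)
    also have "\<dots> \<le> C * (B * c N) powr (3/4) + L / d powr (3/4) * c N powr (3/4)"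
    proof (intro add_mono mult_left_mono)
      have "1 + 4 * c N \<le> c N / d + 4 * c N" using dc d by (simp add: field_simps)
      then show "(1 + 4 * c N) powr (3/4) \<le> (B * c N) powr (3/4)"
        using c_pos[of N] by (intro powr_mono2) (auto simp: B_def algebra_simps)
      have "d powr (3/4) \<le> c N powr (3/4)" using dc d by (intro powr_mono2) auto
      then have "L * 1 \<le> L * (c N powr (3/4) / d powr (3/4))"
        using d by (intro mult_left_mono) (auto simp: L_def field_simps)
      then show "L \<le> L / d powr (3/4) * c N powr (3/4)" by simp
    qed (use C in auto)
    also have "(B * c N) powr (3/4) = B powr (3/4) * c N powr (3/4)"
      using B c_pos[of N] by (simp add: powr_mult)
    also have "C * (B powr (3/4) * c N powr (3/4)) + L / d powr (3/4) * c N powr (3/4) \<le> A * c N powr (3/4)"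
      by (simp add: A_def algebra_simps)
    finally show ?thesis .
  qed
  then show ?thesis using A by blast
qed

text \<open>The zero count inverts to \<open>c N \<ge> (N / A) powr (4/3)\<close>, and
  \<open>4/3 > 1\<close>.\<close>

lemma summable_inverse_c: "summable (\<lambda>n. 1 / c n)"
proof -
  obtain A where A: "A > 0" "\<And>N. real N \<le> A * c N powr (3/4)" using index_le_c_powr by blast
  have le: "1 / c N \<le> A powr (4/3) * real N powr (- (4/3))" if "N \<ge> 1" for N
  proof -
    have "(real N / A) powr (4/3) \<le> (c N powr (3/4)) powr (4/3)"
      using A that by (intro powr_mono2) (auto simp: field_simps)
    also have "\<dots> = c N" using c_pos[of N] by (simp add: powr_powr)
    finally have "1 / c N \<le> 1 / (real N / A) powr (4/3)"
      using A that c_pos[of N] by (intro divide_left_mono) auto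
    also have "\<dots> = A powr (4/3) * real N powr (- (4/3))"
      using A that by (simp add: powr_divide powr_minus_divide)
    finally show ?thesis .
  qed
  show ?thesis
  proof (rule summable_comparison_test_ev)
    show "summable (\<lambda>N. A powr (4/3) * real N powr (- (4/3)))"
      by (intro summable_mult) (simp add: summable_real_powr_iff)
    show "\<forall>\<^sub>F N in sequentially. norm (1 / c N) \<le> A powr (4/3) * real N powr (- (4/3))"
      using eventually_ge_at_top[of 1] by eventually_elim (use le c_pos in \<open>auto simp: less_imp_le\<close>)
  qed
qed

lemma filterlim_c: "filterlim c at_top sequentially"
proof -
  have "(\<lambda>n. inverse (c n)) \<longlonglongrightarrow> 0"
    using summable_LIMSEQ_zero[OF summable_inverse_c] by (simp add: inverse_eq_divide)
  then have "filterlim (\<lambda>n. inverse (inverse (c n))) at_top sequentially"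
    by (rule filterlim_inverse_at_top) (simp add: c_pos)
  then show ?thesis by simp
qed

text \<open>Exponent 0 makes every Weierstrass factor linear; the convergence condition is then
  summability of \<open>1 / c n\<close>.\<close>

sublocale W: weierstrass_product "\<lambda>n. of_real (c n)" "\<lambda>_. 0"
proof
  show "complex_of_real (c n) \<noteq> 0" for n using c_pos[of n] by simp
  show "filterlim (\<lambda>n. complex_of_real (c n)) at_infinity sequentially"
    unfolding filterlim_at_infinity_conv_norm_at_top
    using filterlim_c c_pos by (simp add: less_imp_le)
  show "summable (\<lambda>n. (r / norm (complex_of_real (c n))) ^ Suc 0)" if "r > 0" for r
    using summable_mult[OF summable_inverse_c, of r] c_pos by (simp add: less_imp_le)
qed

lemma W_f_eq: "W.f w = (\<Prod>k. 1 - w / of_real (c k))"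
  unfolding W.f_def by (simp add: weierstrass_factor_def)

lemma P_tendsto: "(\<lambda>N. P N w) \<longlonglongrightarrow> W.f w"
proof -
  have "(\<lambda>n. \<Prod>k\<le>n. 1 - w / of_real (c k)) \<longlonglongrightarrow> W.f w"
    using convergent_prod_LIMSEQ[OF W.convergent[of w]] by (simp add: W.f_def weierstrass_factor_def)
  then have "(\<lambda>n. P (Suc n) w) \<longlonglongrightarrow> W.f w" by (simp add: P_def lessThan_Suc_atMost)
  then show ?thesis by (rule LIMSEQ_imp_Suc)
qed

text \<open>By monotonicity all indices of a zero smaller than \<open>c N\<close> lie below
  \<open>N\<close>, so the first \<open>N\<close> factors already use up its multiplicity.\<close>

lemma E_nonzero:
  assumes all: "\<And>w. H w = 0 \<Longrightarrow> \<exists>k. w = of_real (c k)" and w: "norm w < c N"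
  shows "E N w \<noteq> 0"
proof
  assume Ew: "E N w = 0"
  then have "H w = 0" by (simp add: E_eq[of w N])
  then obtain j where j: "w = of_real (c j)" using all by blast
  have lt: "c j < c N" using w c_pos[of j] by (simp add: j)
  have "{k. k < N \<and> complex_of_real (c k) = w} = {k. c k = c j}"
  proof -
    have "k < N" if "c k = c j" for k
      using lt that c_mono by (metis linorder_not_le monoD)
    then show ?thesis by (auto simp: j)
  qed
  then have "zorder (E N) w = 0"
    using zorder_quotient[OF E_holomorphic E_eq, of w N] mult[of j] by (simp add: j)
  moreover have "zorder (E N) w > 0"
    using zorder_pos_iff[OF E_holomorphic[of N UNIV] open_UNIV UNIV_I, of w]
      quotient_eventually_nonzero[of "E N" N w] Ew E_eq
    by (simp add: eventually_frequently)
  ultimately show False by simp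
qed

text \<open>On the zero-free disc of radius \<open>c N\<close> the quotient is
  \<open>H 0 * exp l\<close> with \<open>l\<close> vanishing at 0. The upper bound for
  \<open>Re l\<close> is sublinear in \<open>c N\<close>, so the bound for \<open>norm l\<close> at
  a fixed point tends to 0.\<close>

lemma E_tendsto:
  assumes all: "\<And>w. H w = 0 \<Longrightarrow> \<exists>k. w = of_real (c k)"
  shows "(\<lambda>N. E N w) \<longlonglongrightarrow> H 0"
proof -
  define L where "L = - ln (norm (H 0))"
  \<comment> \<open>\<open>L\<close> accounts for subtracting the value of the logarithm at 0, and
    the extra 1 makes the bound strict.\<close>
  define A where "A = (\<lambda>x. C * (1 + 4 * x) powr (3/4) + L + 1)"
  have "\<exists>l. E N w = H 0 * exp l \<and> norm l \<le> 2 * A (c N) * norm w / (c N - norm w)" if w: "norm w < c N" for N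
  proof -
    obtain g where g: "g holomorphic_on ball 0 (c N)" "\<And>z. z \<in> ball 0 (c N) \<Longrightarrow> E N z = exp (g z)"
      by (rule contractible_imp_holomorphic_log[of "E N" "ball 0 (c N)"])
         (use E_holomorphic E_nonzero[OF all] in \<open>auto intro: convex_imp_contractible\<close>)
    have e0: "H 0 = exp (g 0)" using g(2)[of 0] c_pos[of N] by (simp add: E_0)
    have ex: "E N z = H 0 * exp (g z - g 0)" if "norm z < c N" for z
      using g(2)[of z] that by (simp add: e0 exp_diff)
    have "norm (g w - g 0) \<le> 2 * A (c N) * norm w / (c N - norm w)"
    proof (rule borel_caratheodory[where f = "\<lambda>z. g z - g 0"])
      show "(\<lambda>z. g z - g 0) holomorphic_on ball 0 (c N)" by (intro holomorphic_intros g)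
      fix z :: complex assume z: "norm z < c N"
      have "exp (Re (g z)) = norm (E N z)" using g(2)[of z] z by simp
      also have "\<dots> \<le> exp (C * (1 + 4 * c N) powr (3/4)) / 3 ^ N"
        using z c_pos[of N] by (intro norm_E_le) auto
      also have "\<dots> \<le> exp (C * (1 + 4 * c N) powr (3/4)) / 1" by (intro divide_left_mono) auto
      finally have "Re (g z) \<le> C * (1 + 4 * c N) powr (3/4)" by simp
      moreover have "Re (g 0) = - L" by (simp add: L_def e0)
      ultimately show "Re (g z - g 0) < A (c N)" by (simp add: A_def)
    qed (use w in auto)
    then show ?thesis using ex[OF w] by blast
  qed
  then obtain l where l: "\<And>N. norm w < c N \<Longrightarrow> E N w = H 0 * exp (l N)"
      "\<And>N. norm w < c N \<Longrightarrow> norm (l N) \<le> 2 * A (c N) * norm w / (c N - norm w)" by metis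
  have ev: "\<forall>\<^sub>F N in sequentially. norm w < c N"
    using filterlim_c by (simp add: filterlim_at_top_dense)
  have "((\<lambda>x::real. (1 + 4 * x) powr (3/4) / (x - norm w)) \<longlongrightarrow> 0) at_top"
    "((\<lambda>x::real. 1 / (x - norm w)) \<longlongrightarrow> 0) at_top"
    by real_asymp+
  then have "((\<lambda>x. 2 * norm w * (C * ((1 + 4 * x) powr (3/4) / (x - norm w)) + (L + 1) * (1 / (x - norm w)))) \<longlongrightarrow>
       2 * norm w * (C * 0 + (L + 1) * 0)) at_top"
    by (intro tendsto_intros)
  then have "((\<lambda>x. 2 * A x * norm w / (x - norm w)) \<longlongrightarrow> 0) at_top"
    by (simp add: A_def add_divide_distrib algebra_simps)
  then have "(\<lambda>N. 2 * A (c N) * norm w / (c N - norm w)) \<longlonglongrightarrow> 0"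
    by (rule filterlim_compose[OF _ filterlim_c])
  then have "l \<longlonglongrightarrow> 0"
    by (rule Lim_null_comparison[rotated]) (use ev in eventually_elim, rule l(2))
  then have "(\<lambda>N. H 0 * exp (l N)) \<longlonglongrightarrow> H 0 * exp 0" by (intro tendsto_intros)
  then have "(\<lambda>N. H 0 * exp (l N)) \<longlonglongrightarrow> H 0" by simp
  moreover have "\<forall>\<^sub>F N in sequentially. H 0 * exp (l N) = E N w"
    using ev by eventually_elim (simp add: l(1))
  ultimately show ?thesis by (rule Lim_transform_eventually)
qed

lemma product_formula:
  assumes "\<And>w. H w = 0 \<Longrightarrow> \<exists>k. w = of_real (c k)"
  shows "H w = H 0 * W.f w"
proof -
  have "(\<lambda>N. E N w * P N w) \<longlonglongrightarrow> H 0 * W.f w"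
    by (intro tendsto_mult E_tendsto P_tendsto assms)
  moreover have "(\<lambda>N. E N w * P N w) = (\<lambda>N. H w)" by (simp add: E_eq[symmetric])
  ultimately show ?thesis by (simp add: LIMSEQ_const_iff)
qed

end

section \<open>The product over the critical zeros\<close>

text \<open>The factorisation \<open>x - x\<^sup>2 - (s - s\<^sup>2) = (x - s) * (1 - x - s)\<close>
  shows that \<open>x \<mapsto> x - x\<^sup>2\<close> takes its value at \<open>s\<close> with
  multiplicity one unless \<open>s = 1 / 2\<close>, and the remaining factor of zeta is nonzero at
  \<open>s\<close>.\<close>

lemma zorder_riemann_zeta_eq_zorder_xi:
  assumes "Re s = 1 / 2" "Im s > 0"
  shows "zorder riemann_zeta s = zorder xi_fun (s - s\<^sup>2)"
proof -
  define w0 where "w0 = s - s\<^sup>2"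
  define n where "n = zorder xi_fun w0"
  define g where "g = zor_poly xi_fun w0"
  have "\<exists>w\<in>UNIV. xi_fun w \<noteq> 0" using xi_fun_0 by (intro bexI[of _ 0]) auto
  note zz = zorder_exist_zero[OF xi_fun_holomorphic open_UNIV connected_UNIV UNIV_I this, of w0]
  have n: "n \<ge> 0" using conjunct1[OF zz] unfolding n_def by (simp split: if_splits)
  obtain r where r: "r > 0" "g holomorphic_on cball w0 r"
      "\<And>w. w \<in> cball w0 r \<Longrightarrow> xi_fun w = g w * (w - w0) ^ nat n" "\<And>w. w \<in> cball w0 r \<Longrightarrow> g w \<noteq> 0"
    using conjunct2[OF zz] unfolding n_def g_def by blast
  define F where "F = (\<lambda>x::complex. of_real pi powr (x / 2) * rGamma (x / 2 + 1) / (x - 1))"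
  define U where "U = (\<lambda>x::complex. x - x\<^sup>2) -` ball w0 r \<inter> - {1}"
  have "zorder riemann_zeta s = n"
  proof (rule zorder_eqI)
    show "open U"
      unfolding U_def by (intro open_Int open_vimage continuous_intros) auto
    have s1: "s \<noteq> 1" using assms by auto
    then show sU: "s \<in> U" using r(1) by (auto simp: U_def w0_def)
    have "(g \<circ> (\<lambda>x. x - x\<^sup>2)) holomorphic_on U"
      by (rule holomorphic_on_compose_gen[of _ _ _ "cball w0 r"]) (auto simp: U_def intro!: holomorphic_intros r)
    then have "(\<lambda>x. g (x - x\<^sup>2)) holomorphic_on U" by (simp add: o_def)
    then show "(\<lambda>x. g (x - x\<^sup>2) * (1 - x - s) ^ nat n * F x) holomorphic_on U"
      unfolding F_def by (intro holomorphic_intros) (auto simp: U_def)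
    have "1 - s - s \<noteq> 0" using assms(2) by (auto simp: complex_eq_iff)
    moreover have "g (s - s\<^sup>2) \<noteq> 0" using r(1) by (intro r(4)) (simp add: w0_def)
    moreover have "F s \<noteq> 0" unfolding F_def using s1 assms by (intro zeta_factor_nonzero) auto
    ultimately show "g (s - s\<^sup>2) * (1 - s - s) ^ nat n * F s \<noteq> 0" by simp
    fix x assume x: "x \<in> U" "x \<noteq> s"
    have "x - x\<^sup>2 - w0 = (x - s) * (1 - x - s)" by (simp add: w0_def power2_eq_square algebra_simps)
    then have "xi_fun (x - x\<^sup>2) = g (x - x\<^sup>2) * ((x - s) * (1 - x - s)) ^ nat n"
      using r(3)[of "x - x\<^sup>2"] x by (simp add: U_def)
    moreover have "riemann_zeta x = xi_fun (x - x\<^sup>2) * F x"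
      using x by (simp add: U_def riemann_zeta_xi F_def)
    ultimately show "riemann_zeta x = g (x - x\<^sup>2) * (1 - x - s) ^ nat n * F x * (x - s) powi n"
      using n by (simp add: power_int_def power_mult_distrib)
  qed
  then show ?thesis by (simp add: n_def w0_def)
qed

text \<open>On the critical line \<open>1 - s\<close> is the conjugate of \<open>s\<close>.\<close>

lemma critical_line_diff_power2:
  assumes "Re s = 1 / 2"
  shows "s - s\<^sup>2 = of_real ((norm s)\<^sup>2)"
proof -
  have "1 - s = cnj s" using assms by (simp add: complex_eq_iff)
  moreover have "s - s\<^sup>2 = s * (1 - s)" by (simp add: power2_eq_square algebra_simps)
  ultimately show ?thesis by (simp only: complex_norm_square)
qed

lemma critical_line_norm_power2: "Re s = 1 / 2 \<Longrightarrow> (norm s)\<^sup>2 = 1 / 4 + (Im s)\<^sup>2"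
  by (simp only: cmod_power2) (simp add: power2_eq_square)

lemma entire_with_zeros_xi:
  assumes z: "lists_critical_zeros z"
  shows "entire_with_zeros xi_fun (\<lambda>n. (norm (z n))\<^sup>2) 15"
proof
  have "z n \<in> critical_zeros" for n
    using z by (auto simp: lists_critical_zeros_def)
  then have crit: "riemann_zeta (z n) = 0" "Re (z n) = 1 / 2" "Im (z n) > 0" for n
    by (auto simp: critical_zeros_def)
  have z1: "z n \<noteq> 1" for n using crit(3)[of n] by auto
  note w = critical_line_diff_power2[OF crit(2)]
  note nn = critical_line_norm_power2[OF crit(2)]
  show "xi_fun holomorphic_on UNIV" by (rule xi_fun_holomorphic)
  show "xi_fun 0 \<noteq> 0" by (simp add: xi_fun_0)
  show "norm (xi_fun w) \<le> exp (15 * (1 + norm w) powr (3/4))" for w by (rule xi_fun_growth)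
  show "(norm (z n))\<^sup>2 > 0" for n by (simp add: nn add_pos_nonneg)
  show "mono (\<lambda>n. (norm (z n))\<^sup>2)"
    using z crit(3) unfolding nn lists_critical_zeros_def
    by (auto simp: mono_def intro!: power_mono intro: less_imp_le)
  show "xi_fun (of_real ((norm (z n))\<^sup>2)) = 0" for n
    using riemann_zeta_eq_0_iff_xi[OF z1, of n] crit[of n] by (simp add: w)
  show "int (card {k. (norm (z k))\<^sup>2 = (norm (z n))\<^sup>2}) = zorder xi_fun (of_real ((norm (z n))\<^sup>2))" for n
  proof -
    \<comment> \<open>On the upper half of the line the modulus determines the point, so occurrences
      in the two sequences are counted alike.\<close>
    have "(norm (z k))\<^sup>2 = (norm (z n))\<^sup>2 \<longleftrightarrow> z k = z n" for k
      using crit(2,3)[of k] crit(2,3)[of n] by (auto simp: nn complex_eq_iff power2_eq_iff)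
    then have "int (card {k. (norm (z k))\<^sup>2 = (norm (z n))\<^sup>2}) = zorder riemann_zeta (z n)"
      using z by (simp add: lists_critical_zeros_def image_subset_iff)
    then show ?thesis
      using zorder_riemann_zeta_eq_zorder_xi[OF crit(2,3)] by (simp add: w)
  qed
qed simp

text \<open>Under the Riemann hypothesis the zeros with real part above \<open>1\<close> are excluded by the Euler product,
  those with real part below \<open>1/2\<close> by the symmetry \<open>s \<mapsto> 1 - s\<close>, and \<open>s = 1/2\<close> by a numerical bound.\<close>
lemma xi_fun_zero_listed:
  assumes z: "lists_critical_zeros z" and RH: riemann_hypothesis and w: "xi_fun w = 0"
  shows "\<exists>n. w = of_real ((norm (z n))\<^sup>2)"
proof -
  \<comment> \<open>The principal root has nonnegative real part, which selects the solution of
    \<open>s - s\<^sup>2 = w\<close> with \<open>Re s \<ge> 1 / 2\<close>.\<close>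
  define s where "s = 1 / 2 + csqrt (1 / 4 - w)"
  have sw: "s - s\<^sup>2 = w"
  proof -
    have "s - s\<^sup>2 = 1 / 4 - (csqrt (1 / 4 - w))\<^sup>2" by (simp add: s_def power2_eq_square field_simps)
    then show ?thesis by simp
  qed
  have "Re s \<ge> 1 / 2" using Re_csqrt[of "1/4 - w"] by (simp add: s_def)
  have "s \<noteq> 1" using w sw xi_fun_0 by auto
  have "riemann_zeta s = 0"
    using riemann_zeta_eq_0_iff_xi[of s] \<open>s \<noteq> 1\<close> \<open>Re s \<ge> 1/2\<close> w by (simp add: sw)
  moreover have "Re s \<le> 1" using riemann_zeta_nonzero_Re_gt_1[of s] calculation by force
  ultimately have Re: "Re s = 1 / 2"
    using RH \<open>s \<noteq> 1\<close> \<open>Re s \<ge> 1/2\<close> unfolding riemann_hypothesis_def by auto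
  have "Im s \<noteq> 0"
  proof
    assume "Im s = 0"
    then have "s = 1 / 2" using Re by (simp add: complex_eq_iff)
    then have "w = 1 / 2 - (1 / 2)\<^sup>2" using sw by (simp only:)
    then have "w = 1 / 4" by (simp add: power2_eq_square)
    then show False using w xi_fun_quarter_nonzero by (simp only: simp_thms)
  qed
  \<comment> \<open>\<open>s\<close> and \<open>1 - s\<close> belong to the same \<open>w\<close>;
    the one in the upper half-plane is a candidate for the list.\<close>
  define t where "t = (if Im s > 0 then s else 1 - s)"
  have t: "Re t = 1 / 2" "Im t > 0" "t - t\<^sup>2 = w"
    using Re \<open>Im s \<noteq> 0\<close> sw by (auto simp: t_def power2_eq_square algebra_simps)
  have "t \<noteq> 1" using t by auto
  then have "riemann_zeta t = 0" using riemann_zeta_eq_0_iff_xi[of t] t w by simp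
  then have "t \<in> critical_zeros" using t by (simp add: critical_zeros_def)
  then have "int (card {n. z n = t}) = zorder xi_fun w"
    using z zorder_riemann_zeta_eq_zorder_xi[OF t(1,2)] by (simp add: lists_critical_zeros_def t(3))
  also have "\<dots> > 0"
  proof -
    interpret entire_with_zeros xi_fun "\<lambda>n. (norm (z n))\<^sup>2" 15 by (rule entire_with_zeros_xi[OF z])
    show ?thesis
      using zorder_pos_iff[OF hol open_UNIV UNIV_I, of w] H_eventually_nonzero[of w] w
      by (simp add: eventually_frequently)
  qed
  finally obtain n where "z n = t" by (auto simp: card_gt_0_iff)
  then show ?thesis using critical_line_diff_power2[OF t(1)] t(3) by auto
qed

text \<open>The identity \<open>rGamma (s / 2) = s / 2 * rGamma (s / 2 + 1)\<close> cancels the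
  factor \<open>s\<close>, so the right-hand side is continuous at 0 and gives the value that
  \<open>remove_sings\<close> assigns there.\<close>

lemma eta_fun_eq:
  assumes h: "h_fun z holomorphic_on UNIV" and s: "s \<noteq> 1"
  shows "eta_fun z s = h_fun z s * (of_real pi powr (s / 2) * rGamma (s / 2 + 1) / (s - 1))"
  unfolding eta_fun_def
proof (rule remove_sings_eqI)
  let ?f = "\<lambda>s. 2 * of_real pi powr (s / 2) * h_fun z s / (s * (s - 1) * Gamma (s / 2))"
  let ?g = "\<lambda>s. h_fun z s * (of_real pi powr (s / 2) * rGamma (s / 2 + 1) / (s - 1))"
  \<comment> \<open>This includes 1 and the negative even integers, where division by zero and the
    value 0 of \<open>Gamma\<close> at its poles make both sides 0.\<close>
  have eq: "?f x = ?g x" if "x \<noteq> 0" for x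
  proof -
    have "?f x = 2 * of_real pi powr (x / 2) * h_fun z x * rGamma (x / 2) / (x * (x - 1))"
      unfolding rGamma_inverse_Gamma divide_inverse inverse_mult_distrib by (simp only: mult_ac)
    also have "rGamma (x / 2) = x / 2 * rGamma (x / 2 + 1)" by (rule rGamma_plus1[symmetric])
    also have "2 * of_real pi powr (x / 2) * h_fun z x * (x / 2 * rGamma (x / 2 + 1)) =
        x * (h_fun z x * (of_real pi powr (x / 2) * rGamma (x / 2 + 1)))" by simp
    also have "\<dots> / (x * (x - 1)) = ?g x" using that by simp
    finally show ?thesis .
  qed
  have "?g holomorphic_on - {1}"
    by (intro holomorphic_intros holomorphic_on_subset[OF h]) auto
  then have "isCont ?g s"
    by (intro holomorphic_on_imp_differentiable_at[THEN field_differentiable_imp_continuous_at]) (use s in auto)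
  then have "?g \<midarrow>s\<rightarrow> ?g s" by (simp add: isCont_def)
  moreover have "\<forall>\<^sub>F x in at s. ?g x = ?f x"
  proof (cases "s = 0")
    case True
    then show ?thesis using eq by (auto simp: eventually_at_filter)
  next
    case False
    then have "\<forall>\<^sub>F x in at s. x \<noteq> 0"
      using eventually_neq_at_within by blast
    then show ?thesis by eventually_elim (simp only: eq not_False_eq_True)
  qed
  ultimately show "?f \<midarrow>s\<rightarrow> ?g s" by (rule Lim_transform_eventually)
qed

theorem theorem2p1:
  fixes z :: "nat \<Rightarrow> complex"
  assumes "lists_critical_zeros z"
  shows "riemann_hypothesis \<longleftrightarrow> (\<forall>s. s \<noteq> 1 \<longrightarrow> riemann_zeta s = eta_fun z s)"
proof -
  define c where "c = (\<lambda>n. (norm (z n))\<^sup>2)"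
  interpret entire_with_zeros xi_fun c 15
    unfolding c_def by (rule entire_with_zeros_xi[OF assms])
  have h_eq: "h_fun z s = 1 / 2 * W.f (s - s\<^sup>2)" for s
    unfolding h_fun_def W_f_eq unfolding c_def by (rule refl)
  have "(W.f \<circ> (\<lambda>s. s - s\<^sup>2)) holomorphic_on UNIV"
    by (rule holomorphic_on_compose_gen[of _ _ _ UNIV]) (auto intro!: holomorphic_intros W.holomorphic)
  then have "h_fun z holomorphic_on UNIV"
    unfolding h_eq[abs_def] o_def by (intro holomorphic_intros) auto
  note eta = eta_fun_eq[OF this]
  show ?thesis
  proof
    assume RH: riemann_hypothesis
    \<comment> \<open>The value \<open>xi_fun 0 = 1 / 2\<close> is the leading constant of
      \<open>h_fun\<close>.\<close>
    have "xi_fun 0 * W.f w = xi_fun w" for w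
      by (rule product_formula[symmetric]) (unfold c_def, rule xi_fun_zero_listed[OF assms RH])
    then show "\<forall>s. s \<noteq> 1 \<longrightarrow> riemann_zeta s = eta_fun z s"
      using eta riemann_zeta_xi h_eq xi_fun_0 by metis
  next
    assume *: "\<forall>s. s \<noteq> 1 \<longrightarrow> riemann_zeta s = eta_fun z s"
    show riemann_hypothesis
      unfolding riemann_hypothesis_def
    proof (intro allI impI, elim conjE)
      fix s assume s: "s \<noteq> 1" "riemann_zeta s = 0" "0 \<le> Re s" "Re s \<le> 1"
      \<comment> \<open>In the strip the Gamma factor has no zeros, so a zero of zeta has to come
        from the product.\<close>
      have "h_fun z s * (of_real pi powr (s / 2) * rGamma (s / 2 + 1) / (s - 1)) = 0"
        using * s eta[OF s(1)] by metis
      then have "h_fun z s = 0"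
        using zeta_factor_nonzero[of s] s by (simp only: mult_eq_0_iff) auto
      then obtain n where n: "s - s\<^sup>2 = of_real ((norm (z n))\<^sup>2)"
        using W.zero[of "s - s\<^sup>2"] unfolding h_eq by (auto simp: c_def)
      have zn: "Re (z n) = 1 / 2"
        using assms unfolding lists_critical_zeros_def critical_zeros_def by blast
      \<comment> \<open>Equal values of \<open>s - s\<^sup>2\<close> leave only
        \<open>s = z n\<close> or \<open>s = 1 - z n\<close>, both on the critical line.\<close>
      have "(s - z n) * (1 - s - z n) = (s - s\<^sup>2) - (z n - (z n)\<^sup>2)"
        by (simp add: power2_eq_square algebra_simps)
      then have "(s - z n) * (1 - s - z n) = 0"
        using n critical_line_diff_power2[OF zn] by simp
      then have "s - z n = 0 \<or> 1 - s - z n = 0" by (simp only: mult_eq_0_iff)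
      then have "Re s = Re (z n) \<or> Re s = 1 - Re (z n)"
        by (auto simp: complex_eq_iff)
      then show "Re s = 1 / 2" using zn by auto
    qed
  qed
qed

end
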